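(* Let $G$ be a non-elementary hyperbolic group. Then for every finite generating set $S$ of $G$, the limit $E(G,S)$ exists and $E(G,S)=2$.
   Context: For a group $G$ with finite generating set $S$, let $d$ be the word metric on $G$ with respect to $S$ (distance in the Cayley graph between group elements), and let $S_n=\{x\in G: d(e,x)=n\}$ be the sphere of radius $n$ about the identity $e$. The sprawl of $(G,S)$ is $$E(G,S):=\lim_{n\to\infty}\frac{1}{|S_n|^2}\sum_{x,y\in S_n}\frac1n\, d(x,y),$$ provided the limit exists. A hyperbolic group is a finitely generated group whose Cayley graph is $\delta$-hyperbolic for some $\delta$ (every side of every geodesic triangle is contained in the $\delta$-neighborhood of the union of the other two sides). A hyperbolic group is elementary if it is finite or has a finite-index cyclic subgroup; otherwise it is non-elementary. *)

theory Defs
  imports "HOL-Analysis.Analysis" "HOL-Algebra.Generated_Groups" "HOL-Algebra.Coset"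
begin

definition finite_generating_set :: "('a, 'b) monoid_scheme \<Rightarrow> 'a set \<Rightarrow> bool" where
  "finite_generating_set G S \<longleftrightarrow> finite S \<and> S \<subseteq> carrier G \<and> generate G S = carrier G"

(* S need not be symmetric: words are taken over S and the inverses of its elements. *)
definition word_length :: "('a, 'b) monoid_scheme \<Rightarrow> 'a set \<Rightarrow> 'a \<Rightarrow> nat" where
  "word_length G S x =
     (LEAST n. \<exists>ws. set ws \<subseteq> S \<union> m_inv G ` S \<and> length ws = n
                   \<and> foldr (\<lambda>a b. a \<otimes>\<^bsub>G\<^esub> b) ws \<one>\<^bsub>G\<^esub> = x)"

definition word_dist :: "('a, 'b) monoid_scheme \<Rightarrow> 'a set \<Rightarrow> 'a \<Rightarrow> 'a \<Rightarrow> nat" where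
  "word_dist G S x y = word_length G S (inv\<^bsub>G\<^esub> x \<otimes>\<^bsub>G\<^esub> y)"

definition word_sphere :: "('a, 'b) monoid_scheme \<Rightarrow> 'a set \<Rightarrow> nat \<Rightarrow> 'a set" where
  "word_sphere G S n = {x \<in> carrier G. word_dist G S \<one>\<^bsub>G\<^esub> x = n}"

definition sprawl_seq :: "('a, 'b) monoid_scheme \<Rightarrow> 'a set \<Rightarrow> nat \<Rightarrow> real" where
  "sprawl_seq G S n =
     1 / (real (card (word_sphere G S n)))\<^sup>2 *
     (\<Sum>x\<in>word_sphere G S n. \<Sum>y\<in>word_sphere G S n. 1 / real n * real (word_dist G S x y))"

definition sprawl :: "('a, 'b) monoid_scheme \<Rightarrow> 'a set \<Rightarrow> real" where
  "sprawl G S = lim (sprawl_seq G S)"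

definition geodesic_segment :: "'p set \<Rightarrow> ('p \<Rightarrow> 'p \<Rightarrow> real) \<Rightarrow> 'p \<Rightarrow> 'p \<Rightarrow> 'p set \<Rightarrow> bool" where
  "geodesic_segment M d x y A \<longleftrightarrow>
     (\<exists>L\<ge>0. \<exists>g. g 0 = x \<and> g L = y \<and> A = g ` {0..L} \<and> A \<subseteq> M
        \<and> (\<forall>s\<in>{0..L}. \<forall>t\<in>{0..L}. d (g s) (g t) = \<bar>s - t\<bar>))"

definition delta_hyperbolic :: "'p set \<Rightarrow> ('p \<Rightarrow> 'p \<Rightarrow> real) \<Rightarrow> real \<Rightarrow> bool" where
  "delta_hyperbolic M d \<delta> \<longleftrightarrow>
     (\<forall>x y z A B C. geodesic_segment M d x y A \<longrightarrow> geodesic_segment M d y z B \<longrightarrow>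
        geodesic_segment M d z x C \<longrightarrow>
        (\<forall>p\<in>A. \<exists>q\<in>B \<union> C. d p q \<le> \<delta>) \<and>
        (\<forall>p\<in>B. \<exists>q\<in>C \<union> A. d p q \<le> \<delta>) \<and>
        (\<forall>p\<in>C. \<exists>q\<in>A \<union> B. d p q \<le> \<delta>))"

(* The Cayley graph as a metric graph: x and y span an edge of length 1 iff word_dist G S x y = 1
   (loops and repeated edges are dropped). A point is given by its barycentric coordinates, so the
   vertex x is the indicator function of x (take x = y below), and the other points of an edge
   are the functions with support {x, y} and total weight 1. *)
definition cayley_graph :: "('a, 'b) monoid_scheme \<Rightarrow> 'a set \<Rightarrow> ('a \<Rightarrow> real) set" where
  "cayley_graph G S =
     {p. \<exists>x\<in>carrier G. \<exists>y\<in>carrier G. \<exists>t\<in>{0..1}. word_dist G S x y \<le> 1 \<and>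
           p = (\<lambda>v. (1 - t) * of_bool (v = x) + t * of_bool (v = y))}"

definition bary_supp :: "('a \<Rightarrow> real) \<Rightarrow> 'a set" where
  "bary_supp p = {v. p v \<noteq> 0}"

(* The path metric. On an edge, the point p lies at distance 1 - p u from its endpoint u; points
   with the same support lie on a common edge, and any other path between two points passes
   through an endpoint u of the edge of the first and an endpoint v of the edge of the second. *)
definition cayley_dist ::
  "('a, 'b) monoid_scheme \<Rightarrow> 'a set \<Rightarrow> ('a \<Rightarrow> real) \<Rightarrow> ('a \<Rightarrow> real) \<Rightarrow> real" where
  "cayley_dist G S p q =
     (if bary_supp p = bary_supp q then (\<Sum>v\<in>bary_supp p. \<bar>p v - q v\<bar>) / 2
      else Min ((\<lambda>(u, v). (1 - p u) + real (word_dist G S u v) + (1 - q v)) `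
                (bary_supp p \<times> bary_supp q)))"

definition hyperbolic_group :: "('a, 'b) monoid_scheme \<Rightarrow> bool" where
  "hyperbolic_group G \<longleftrightarrow>
     group G \<and>
     (\<exists>S. finite_generating_set G S \<and>
          (\<exists>\<delta>. delta_hyperbolic (cayley_graph G S) (cayley_dist G S) \<delta>))"

definition elementary_group :: "('a, 'b) monoid_scheme \<Rightarrow> bool" where
  "elementary_group G \<longleftrightarrow>
     finite (carrier G) \<or> (\<exists>g\<in>carrier G. finite (rcosets\<^bsub>G\<^esub> (generate G {g})))"

end

theory Submission
  imports Defs "HOL-Real_Asymp.Real_Asymp"
begin

text \<open>Suppose that \<open>x\<close> and \<open>y\<close> on the sphere of radius \<open>n\<close> satisfy \<open>d x y \<le> (2 - 2 * \<epsilon>) * n\<close>. In a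
  hyperbolic metric the geodesics from \<open>\<one>\<close> to \<open>x\<close> and to \<open>y\<close> fellow-travel up to distance about
  \<open>\<epsilon> * n\<close> from \<open>\<one>\<close>, so for fixed \<open>x\<close> there are at most about \<open>card (S\<^sub>m)\<close> such \<open>y\<close>,
  where \<open>m = (1 - \<epsilon>) * n\<close>. By submultiplicativity \<open>card (S\<^sub>n)\<close> is \<open>exp (h * n)\<close> up to a
  subexponential factor, hence such \<open>y\<close> are exponentially rare as soon as \<open>h > 0\<close>, and almost all
  pairs have distance at least \<open>(2 - 2 * \<epsilon>) * n\<close>.

  Since subexponential errors are harmless, invariance of hyperbolicity under change of
  generators (the Morse lemma) is not needed: it is enough that geodesics of the given word metric
  come within \<open>O(log n)\<close> of those of the hyperbolic one, which follows from the four-point condition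
  by repeated halving.

  For \<open>h > 0\<close>, an infinite hyperbolic group contains an element \<open>g\<close> that acts like a translation. If
  its cyclic subgroup has infinite index, then an element far from it, together with a large positive
  and a large negative power of \<open>g\<close>, forms a tripod; any group element can be extended by two of the
  three legs without much backtracking, which yields an embedded binary tree.\<close>

section \<open>Word metrics\<close>

locale word_metric = group G for G :: "('a, 'b) monoid_scheme" (structure) +
  fixes S :: "'a set"
  assumes generating: "finite_generating_set G S"
begin

abbreviation len :: "'a \<Rightarrow> nat" where "len \<equiv> word_length G S"
abbreviation d :: "'a \<Rightarrow> 'a \<Rightarrow> nat" where "d \<equiv> word_dist G S"
abbreviation eval_word :: "'a list \<Rightarrow> 'a" where "eval_word ws \<equiv> foldr (\<otimes>) ws \<one>"
abbreviation letters :: "'a set" where "letters \<equiv> S \<union> m_inv G ` S"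

definition ball_at_one :: "nat \<Rightarrow> 'a set" where
  "ball_at_one n = {x \<in> carrier G. len x \<le> n}"

lemma mult_inv_cancel [simp]:
  assumes "x \<in> carrier G" "y \<in> carrier G"
  shows "x \<otimes> (inv x \<otimes> y) = y" "inv x \<otimes> (x \<otimes> y) = y"
  using assms by (simp_all flip: m_assoc)

lemma letters_closed: "letters \<subseteq> carrier G"
  using generating by (auto simp: finite_generating_set_def)

lemma finite_letters: "finite letters"
  using generating by (auto simp: finite_generating_set_def)

lemma eval_word_closed: "set ws \<subseteq> letters \<Longrightarrow> eval_word ws \<in> carrier G"
  using letters_closed by (induction ws) auto

lemma eval_word_append:
  "set us \<subseteq> letters \<Longrightarrow> set ws \<subseteq> letters \<Longrightarrow> eval_word (us @ ws) = eval_word us \<otimes> eval_word ws"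
proof (induction us)
  case (Cons a us)
  then show ?case
    using letters_closed eval_word_closed[of us] eval_word_closed[of ws] by (auto simp: m_assoc)
qed (auto simp: eval_word_closed)

lemma ex_word:
  assumes "x \<in> carrier G"
  shows "\<exists>ws. set ws \<subseteq> letters \<and> eval_word ws = x"
proof -
  have "x \<in> generate G S"
    using assms generating by (simp add: finite_generating_set_def)
  then show ?thesis
  proof (induction rule: generate.induct)
    case one
    show ?case by (rule exI[of _ "[]"]) auto
  next
    case (incl h)
    then show ?case using letters_closed by (intro exI[of _ "[h]"]) auto
  next
    case (inv h)
    then show ?case using letters_closed by (intro exI[of _ "[inv h]"]) auto
  next
    case (eng h1 h2)
    then obtain us ws where "set us \<subseteq> letters" "eval_word us = h1" "set ws \<subseteq> letters" "eval_word ws = h2"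
      by blast
    then show ?case
      using eval_word_append[of us ws] by (intro exI[of _ "us @ ws"]) auto
  qed
qed

lemma ex_geodesic_word:
  assumes "x \<in> carrier G"
  obtains ws where "set ws \<subseteq> letters" "eval_word ws = x" "length ws = len x"
proof -
  have "\<exists>n ws. set ws \<subseteq> letters \<and> length ws = n \<and> eval_word ws = x"
    using ex_word[OF assms] by blast
  from LeastI_ex[OF this] show ?thesis
    using that unfolding word_length_def by blast
qed

lemma len_eval_word_le: "set ws \<subseteq> letters \<Longrightarrow> len (eval_word ws) \<le> length ws"
  unfolding word_length_def by (rule Least_le) auto

lemma len_one [simp]: "len \<one> = 0"
  using len_eval_word_le[of "[]"] by simp

lemma len_mult_le:
  assumes "x \<in> carrier G" "y \<in> carrier G"
  shows "len (x \<otimes> y) \<le> len x + len y"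
proof -
  obtain us where us: "set us \<subseteq> letters" "eval_word us = x" "length us = len x"
    using ex_geodesic_word[OF assms(1)] .
  obtain ws where ws: "set ws \<subseteq> letters" "eval_word ws = y" "length ws = len y"
    using ex_geodesic_word[OF assms(2)] .
  show ?thesis
    using len_eval_word_le[of "us @ ws"] us ws by (simp only: eval_word_append) auto
qed

lemma len_inv_le:
  assumes "x \<in> carrier G"
  shows "len (inv x) \<le> len x"
proof -
  have "\<exists>us. set us \<subseteq> letters \<and> length us = length ws \<and> eval_word us = inv (eval_word ws)"
    if "set ws \<subseteq> letters" for ws
    using that
  proof (induction ws)
    case (Cons a ws)
    then obtain us where us: "set us \<subseteq> letters" "length us = length ws" "eval_word us = inv (eval_word ws)"
      by auto
    have a: "a \<in> carrier G" "inv a \<in> letters"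
      using Cons.prems letters_closed generating
      by (auto simp: finite_generating_set_def)
    have "eval_word (us @ [inv a]) = inv (eval_word (a # ws))"
      using eval_word_append[of us "[inv a]"] us a eval_word_closed[of ws] Cons.prems
      by (simp add: inv_mult_group)
    then show ?case
      using us a by (intro exI[of _ "us @ [inv a]"]) auto
  qed auto
  then show ?thesis
    using ex_geodesic_word[OF assms] len_eval_word_le by metis
qed

lemma len_inv [simp]: "x \<in> carrier G \<Longrightarrow> len (inv x) = len x"
  using len_inv_le[of x] len_inv_le[of "inv x"] by simp

text \<open>Cut a shortest word for \<open>x\<close> after \<open>m\<close> letters. Neither piece
  can be replaced by a shorter word, since that would shorten the word for \<open>x\<close>.\<close>

lemma len_split:
  assumes "x \<in> carrier G" "len x = m + n"
  obtains u v where "u \<in> carrier G" "v \<in> carrier G" "x = u \<otimes> v" "len u = m" "len v = n"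
proof -
  obtain ws where ws: "set ws \<subseteq> letters" "eval_word ws = x" "length ws = len x"
    using ex_geodesic_word[OF assms(1)] .
  define us vs where "us = take m ws" and "vs = drop m ws"
  have sub: "set us \<subseteq> letters" "set vs \<subseteq> letters"
    using ws(1) set_take_subset[of m ws] set_drop_subset[of m ws] by (auto simp: us_def vs_def)
  have x: "x = eval_word us \<otimes> eval_word vs"
    using eval_word_append[OF sub] ws(2) by (simp add: us_def vs_def)
  have "len (eval_word us) \<le> m" "len (eval_word vs) \<le> n"
    using len_eval_word_le[OF sub(1)] len_eval_word_le[OF sub(2)] ws(3) assms(2)
    by (auto simp: us_def vs_def)
  moreover have "m + n \<le> len (eval_word us) + len (eval_word vs)"
    using len_mult_le[of "eval_word us" "eval_word vs"] sub eval_word_closed x assms(2) by metis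
  ultimately show ?thesis
    using that[of "eval_word us" "eval_word vs"] sub eval_word_closed x by auto
qed

lemma d_one: "x \<in> carrier G \<Longrightarrow> d \<one> x = len x"
  by (simp add: word_dist_def)

lemma d_self [simp]: "x \<in> carrier G \<Longrightarrow> d x x = 0"
  by (simp add: word_dist_def)

lemma d_commute: 
  assumes "x \<in> carrier G" "y \<in> carrier G" 
  shows "d x y = d y x"
proof -
  have "inv (inv x \<otimes> y) = inv y \<otimes> x"
    using assms by (simp add: inv_mult_group)
  then show ?thesis
    using len_inv[of "inv x \<otimes> y"] assms by (simp add: word_dist_def)
qed

lemma d_mult_left:
  assumes "g \<in> carrier G" "x \<in> carrier G" "y \<in> carrier G"
  shows "d (g \<otimes> x) (g \<otimes> y) = d x y"
proof -
  have "inv (g \<otimes> x) \<otimes> (g \<otimes> y) = inv x \<otimes> y"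
    using assms by (simp add: inv_mult_group m_assoc)
  then show ?thesis by (simp add: word_dist_def)
qed

lemma d_triangle:
  assumes "x \<in> carrier G" "y \<in> carrier G" "z \<in> carrier G"
  shows "d x z \<le> d x y + d y z"
proof -
  have "inv x \<otimes> z = (inv x \<otimes> y) \<otimes> (inv y \<otimes> z)"
    using assms by (simp add: m_assoc)
  then show ?thesis
    using len_mult_le[of "inv x \<otimes> y" "inv y \<otimes> z"] assms by (simp add: word_dist_def)
qed

lemma word_sphere_eq: "word_sphere G S n = {x \<in> carrier G. len x = n}"
  by (auto simp: word_sphere_def d_one)

lemma finite_ball_at_one: "finite (ball_at_one n)"
proof -
  have "ball_at_one n \<subseteq> eval_word ` {ws. set ws \<subseteq> letters \<and> length ws \<le> n}"
    using ex_geodesic_word by (force simp: ball_at_one_def)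
  then show ?thesis
    using finite_lists_length_le[OF finite_letters] by (meson finite_imageI finite_subset)
qed

lemma finite_word_sphere: "finite (word_sphere G S n)"
  by (rule finite_subset[OF _ finite_ball_at_one[of n]]) (auto simp: word_sphere_eq ball_at_one_def)

lemma word_sphere_nonempty:
  assumes "infinite (carrier G)"
  shows "word_sphere G S n \<noteq> {}"
proof -
  obtain x where x: "x \<in> carrier G" "x \<notin> ball_at_one n"
    using assms finite_ball_at_one[of n] by (meson finite_subset subsetI)
  then have "len x = n + (len x - n)" by (simp add: ball_at_one_def)
  from len_split[OF x(1) this] show ?thesis
    by (metis (mono_tags, lifting) empty_iff mem_Collect_eq word_sphere_eq)
qed

text \<open>Only the values of \<open>w\<close> up to \<open>d x y\<close> are constrained. The case
  distinction avoids truncated subtraction.\<close>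

definition geodesic :: "(nat \<Rightarrow> 'a) \<Rightarrow> 'a \<Rightarrow> 'a \<Rightarrow> bool" where
  "geodesic w x y \<longleftrightarrow> w 0 = x \<and> w (d x y) = y \<and> (\<forall>i\<le>d x y. w i \<in> carrier G)
     \<and> (\<forall>i\<le>d x y. \<forall>j\<le>d x y. d (w i) (w j) = (if i \<le> j then j - i else i - j))"

lemma ex_geodesic:
  assumes "x \<in> carrier G" "y \<in> carrier G"
  obtains w where "geodesic w x y"
proof -
  obtain ws where ws: "set ws \<subseteq> letters" "eval_word ws = inv x \<otimes> y" "length ws = d x y"
    using ex_geodesic_word[of "inv x \<otimes> y"] assms unfolding word_dist_def by auto
  define w where "w = (\<lambda>i. x \<otimes> eval_word (take i ws))"
  have sub: "set (take i ws) \<subseteq> letters" "set (drop i ws) \<subseteq> letters" for i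
    using ws(1) set_take_subset[of i ws] set_drop_subset[of i ws] by auto
  have w_closed: "w i \<in> carrier G" for i
    using assms eval_word_closed[OF sub(1)] by (simp add: w_def)
  have w0: "w 0 = x"
    using assms by (simp add: w_def)
  have wL: "w (d x y) = y"
    using assms ws by (simp add: w_def)
  have step: "d (w i) (w j) \<le> j - i" if "i \<le> j" "j \<le> d x y" for i j
  proof -
    define us where "us = drop i (take j ws)"
    have us: "set us \<subseteq> letters"
      using sub(1)[of j] set_drop_subset[of i "take j ws"] by (auto simp: us_def)
    have "take j ws = take i ws @ us"
      using that by (metis us_def append_take_drop_id min.absorb1 take_take)
    then have "w j = w i \<otimes> eval_word us"
      using eval_word_append[OF sub(1)[of i] us] assms eval_word_closed[OF us] eval_word_closed[OF sub(1)[of i]]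
      by (simp only: w_def) (simp add: m_assoc)
    then have "inv (w i) \<otimes> w j = eval_word us"
      using w_closed[of i] eval_word_closed[OF us] by (simp flip: m_assoc)
    then show ?thesis
      using len_eval_word_le[OF us] that ws(3) by (simp add: word_dist_def us_def)
  qed
  \<comment> \<open>The path has no slack: by \<open>step\<close> its three pieces sum to at most
    \<open>d x y\<close>, by the triangle inequality to at least that, so each bound is
    attained.\<close>
  have eq: "d (w i) (w j) = j - i" if "i \<le> j" "j \<le> d x y" for i j
  proof -
    have "d x y \<le> d (w 0) (w i) + d (w i) (w j) + d (w j) (w (d x y))"
      using d_triangle[of x "w i" y] d_triangle[of "w i" "w j" y] w_closed assms w0 wL by simp
    moreover have "d (w 0) (w i) \<le> i" "d (w j) (w (d x y)) \<le> d x y - j" "d (w i) (w j) \<le> j - i"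
      using step[of 0 i] step[of j "d x y"] step[of i j] that by auto
    ultimately show ?thesis using that by linarith
  qed
  have "geodesic w x y"
    unfolding geodesic_def
  proof (intro conjI allI impI)
    show "d (w i) (w j) = (if i \<le> j then j - i else i - j)" if "i \<le> d x y" "j \<le> d x y" for i j
      using eq[of i j] eq[of j i] d_commute[OF w_closed w_closed, of i j] that by auto
  qed (use w0 wL w_closed in auto)
  then show ?thesis by (rule that)
qed

lemma geodesic_ends:
  assumes "geodesic w x y" "k \<le> d x y"
  shows "w k \<in> carrier G" "d x (w k) = k" "d (w k) y = d x y - k"
proof -
  show "w k \<in> carrier G"
    using assms by (simp add: geodesic_def)
  have D: "d (w i) (w j) = (if i \<le> j then j - i else i - j)" if "i \<le> d x y" "j \<le> d x y" for i j
    using assms that unfolding geodesic_def by blast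
  have "d (w 0) (w k) = k" "d (w k) (w (d x y)) = d x y - k"
    using D[of 0 k] D[of k "d x y"] assms(2) by simp_all
  moreover have "w 0 = x" "w (d x y) = y"
    using assms(1) by (auto simp only: geodesic_def)
  ultimately show "d x (w k) = k" "d (w k) y = d x y - k"
    by metis+
qed

lemma geodesic_inj:
  assumes "geodesic w x y" "i \<le> d x y" "j \<le> d x y" "w i = w j"
  shows "i = j"
  using geodesic_ends(2)[OF assms(1,2)] geodesic_ends(2)[OF assms(1,3)] assms(4) by metis

end

text \<open>Spell each letter over \<open>S\<close> as a word over \<open>S'\<close>;
  \<open>K\<close> is the largest length that occurs, and \<open>insert 0\<close> covers an empty
  alphabet. Used in both directions, this compares two word metrics up to a factor.\<close>

lemma word_length_bilipschitz:
  assumes "word_metric G S" "word_metric G S'"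
  obtains K :: nat where "\<And>x. x \<in> carrier G \<Longrightarrow> word_length G S' x \<le> K * word_length G S x"
proof -
  interpret S: word_metric G S by fact
  interpret S': word_metric G S' by fact
  define K where "K = Max (insert 0 (S'.len ` S.letters))"
  have K: "S'.len a \<le> K" if "a \<in> S.letters" for a
    using that S.finite_letters by (auto simp: K_def intro!: Max_ge)
  have "S'.len (S.eval_word ws) \<le> K * length ws" if "set ws \<subseteq> S.letters" for ws
    using that
  proof (induction ws)
    case (Cons a ws)
    then show ?case
      using S'.len_mult_le[of a "S.eval_word ws"] S.letters_closed S.eval_word_closed[of ws] K[of a]
      by auto
  qed auto
  then show ?thesis
    using that S.ex_geodesic_word by metis
qed

section \<open>Gromov products\<close>

context word_metric
begin

definition gromov_product :: "'a \<Rightarrow> 'a \<Rightarrow> 'a \<Rightarrow> real" where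
  "gromov_product w x y = (real (d w x) + real (d w y) - real (d x y)) / 2"

abbreviation gp :: "'a \<Rightarrow> 'a \<Rightarrow> real" where "gp \<equiv> gromov_product \<one>"

lemma gp_eq:
  assumes "x \<in> carrier G" "y \<in> carrier G"
  shows "gp x y = (real (len x) + real (len y) - real (d x y)) / 2"
  using assms by (simp add: gromov_product_def d_one)

lemma gromov_product_commute:
  assumes "x \<in> carrier G" "y \<in> carrier G"
  shows "gromov_product w x y = gromov_product w y x"
  using d_commute[OF assms] by (simp add: gromov_product_def)

lemma gromov_product_nonneg:
  assumes "w \<in> carrier G" "x \<in> carrier G" "y \<in> carrier G"
  shows "0 \<le> gromov_product w x y"
  using d_triangle[of x w y] d_commute[of x w] assms by (simp add: gromov_product_def)

lemma gromov_product_le: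
  assumes "w \<in> carrier G" "x \<in> carrier G" "y \<in> carrier G"
  shows "gromov_product w x y \<le> d w x" "gromov_product w x y \<le> d w y"
  using d_triangle[of w x y] d_triangle[of w y x] d_commute[of x y] assms
  by (simp_all add: gromov_product_def)

text \<open>\<open>gp (inv x) y\<close> measures the cancellation in \<open>x \<otimes> y\<close>;
  what is left of \<open>x\<close> is how far the product follows \<open>x\<close>.\<close>

lemma gp_mult_left:
  assumes "x \<in> carrier G" "y \<in> carrier G"
  shows "gp x (x \<otimes> y) = len x - gp (inv x) y"
proof -
  have "d x (x \<otimes> y) = len y" "d (inv x) y = len (x \<otimes> y)"
    using assms by (simp_all add: word_dist_def)
  then show ?thesis using assms by (simp add: gp_eq field_simps)
qed

lemma len_mult_eq:
  assumes "x \<in> carrier G" "y \<in> carrier G"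
  shows "real (len (x \<otimes> y)) = len x + len y - 2 * gp (inv x) y"
proof -
  have "d (inv x) y = len (x \<otimes> y)"
    using assms by (simp add: word_dist_def)
  then show ?thesis using assms by (simp add: gp_eq field_simps)
qed

end

text \<open>Hyperbolicity enters as the four-point condition because this speaks of group elements
  only. It is derived from slim triangles in \<open>hyperbolic_word_metric_of_slim\<close>.\<close>

locale hyperbolic_word_metric = word_metric +
  fixes \<delta> :: real
  assumes four_point: "\<lbrakk>w \<in> carrier G; x \<in> carrier G; y \<in> carrier G; z \<in> carrier G\<rbrakk> \<Longrightarrow>
    min (gromov_product w x y) (gromov_product w y z) - \<delta> \<le> gromov_product w x z"
begin

lemma delta_nonneg: "0 \<le> \<delta>"
  using four_point[of \<one> \<one> \<one> \<one>] by (simp add: gromov_product_def)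

lemma four_point_cases:
  assumes "w \<in> carrier G" "x \<in> carrier G" "y \<in> carrier G" "z \<in> carrier G"
  shows "gromov_product w x y - \<delta> \<le> gromov_product w x z \<or> gromov_product w y z - \<delta> \<le> gromov_product w x z"
  using four_point[OF assms] by linarith

section \<open>Exponential growth from a large tripod\<close>

text \<open>If three long elements point in different directions, then every group element can be
  extended by at least two of them without much backtracking.\<close>

definition tripod :: "real \<Rightarrow> real \<Rightarrow> 'a \<Rightarrow> 'a \<Rightarrow> 'a \<Rightarrow> bool" where
  "tripod C R a b c \<longleftrightarrow> {a, b, c} \<subseteq> carrier G \<and> R < len a \<and> R < len b \<and> R < len c
     \<and> gp a b \<le> C \<and> gp a c \<le> C \<and> gp b c \<le> C"

text \<open>If \<open>inv p\<close> followed two legs \<open>u\<close> and \<open>v\<close> beyond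
  \<open>C + \<delta>\<close>, the four-point condition would force \<open>gp u v > C\<close>. So at
  most one leg is bad for \<open>p\<close>.\<close>

lemma ex_two_extensions:
  assumes "tripod C R a b c" "p \<in> carrier G"
  shows "\<exists>u v. u \<in> {a, b, c} \<and> v \<in> {a, b, c} \<and> gp u v \<le> C
           \<and> gp (inv p) u \<le> C + \<delta> \<and> gp (inv p) v \<le> C + \<delta>"
proof -
  have "gp (inv p) u \<le> C + \<delta> \<or> gp (inv p) v \<le> C + \<delta>"
    if "u \<in> {a, b, c}" "v \<in> {a, b, c}" "gp u v \<le> C" for u v
    using four_point[of \<one> u "inv p" v] gromov_product_commute[of u "inv p" \<one>] assms that
    by (auto simp: tripod_def min_def split: if_splits)
  then show ?thesis
    using assms unfolding tripod_def by (smt (verit) insertI1 insertI2)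
qed

text \<open>Choosing between two good legs at every step gives a binary tree in the group, indexed
  by boolean lists. Its nodes at depth \<open>n\<close> are distinct and lie in the ball of radius
  \<open>M * n\<close>.\<close>

lemma exponential_ball_of_tripod:
  assumes "tripod C R a b c" "0 \<le> C" "3 * C + 4 * \<delta> \<le> R"
  obtains M where "\<And>n. 2 ^ n \<le> card (ball_at_one (M * n))"
proof -
  define e where "e = C + \<delta>"
  define M where "M = len a + len b + len c"
  have "\<forall>p\<in>carrier G. \<exists>u v. u \<in> {a, b, c} \<and> v \<in> {a, b, c} \<and> gp u v \<le> C
           \<and> gp (inv p) u \<le> C + \<delta> \<and> gp (inv p) v \<le> C + \<delta>"
    using ex_two_extensions[OF assms(1)] by blast
  then obtain u v where uv: "\<And>p. p \<in> carrier G \<Longrightarrow> u p \<in> {a, b, c} \<and> v p \<in> {a, b, c}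
      \<and> gp (u p) (v p) \<le> C \<and> gp (inv p) (u p) \<le> e \<and> gp (inv p) (v p) \<le> e"
    unfolding e_def by metis
  define ext where "ext = (\<lambda>p h. if h then u p else v p)"
  have ext: "ext p h \<in> carrier G" "R < len (ext p h)" "gp (inv p) (ext p h) \<le> e" "len (ext p h) \<le> M"
    if "p \<in> carrier G" for p h
    using uv[OF that] assms(1) unfolding ext_def tripod_def M_def by auto
  have ext_gp: "gp (ext p h) (ext p (\<not> h)) \<le> C" if "p \<in> carrier G" for p h
  proof (cases h)
    case False
    then show ?thesis
      using uv[OF that] gromov_product_commute[of "u p" "v p" \<one>] ext(1)[OF that, of True] ext(1)[OF that, of False]
      by (simp add: ext_def)
  qed (use uv[OF that] in \<open>simp add: ext_def\<close>)
  define node where "node = foldl (\<lambda>p h. p \<otimes> ext p h)"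
  have node_simps: "node p [] = p" "node p (h # hs) = node (p \<otimes> ext p h) hs" for p h hs
    by (simp_all add: node_def)
  have node_closed: "node p hs \<in> carrier G" if "p \<in> carrier G" for p hs
    using that by (induction hs arbitrary: p) (auto simp: node_simps ext)
  have node_len: "len (node p hs) \<le> len p + M * length hs" if "p \<in> carrier G" for p hs
    using that
  proof (induction hs arbitrary: p)
    case (Cons h hs)
    have "len (node p (h # hs)) \<le> len (p \<otimes> ext p h) + M * length hs"
      using Cons.IH[of "p \<otimes> ext p h"] Cons.prems ext(1)[of p h] by (simp add: node_simps)
    moreover have "len (p \<otimes> ext p h) \<le> len p + M"
      using len_mult_le[of p "ext p h"] ext[of p h] Cons.prems by simp
    ultimately show ?case by simp
  qed (simp add: node_simps)
  have len_ext: "len (p \<otimes> ext p h) \<ge> len p + len (ext p h) - 2 * e" if "p \<in> carrier G" for p h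
    using len_mult_eq[of p "ext p h"] ext[OF that, of h] that by simp
  \<comment> \<open>All descendants of \<open>p\<close> follow \<open>p\<close> almost to its end.
    In the induction the child is longer than \<open>p\<close> by at least \<open>R - 2 * e\<close>,
    which is at least \<open>\<delta>\<close> and pays for one use of the four-point
    condition.\<close>
  have shadow: "gp p (node p hs) \<ge> len p - e - \<delta>" if "p \<in> carrier G" for p hs
    using that
  proof (induction hs arbitrary: p)
    case Nil
    then show ?case using assms(2) delta_nonneg by (simp add: node_simps gp_eq e_def)
  next
    case (Cons h hs)
    define q where "q = p \<otimes> ext p h"
    have q: "q \<in> carrier G" using Cons.prems ext by (simp add: q_def)
    have "gp q (node q hs) \<ge> len q - e - \<delta>" using Cons.IH[OF q] .
    moreover have "real (len q) \<ge> len p + R - 2 * e"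
      using len_ext[OF Cons.prems, of h] ext(2)[OF Cons.prems, of h] by (simp add: q_def)
    moreover have "gp p q \<ge> len p - e"
      using gp_mult_left[of p "ext p h"] ext[OF Cons.prems, of h] Cons.prems by (simp add: q_def)
    moreover have "gp p q - \<delta> \<le> gp p (node q hs) \<or> gp q (node q hs) - \<delta> \<le> gp p (node q hs)"
      using four_point_cases[of \<one> p q "node q hs"] q Cons.prems node_closed by simp
    moreover have "node p (h # hs) = node q hs" by (simp add: node_simps q_def)
    ultimately show ?case
      using assms(2,3) delta_nonneg unfolding e_def by auto
  qed
  have node_inj: "hs = hs'" if "p \<in> carrier G" "length hs = length hs'" "node p hs = node p hs'" for p hs hs'
    using that
  proof (induction hs arbitrary: p hs')
    case (Cons h hs)
    then obtain h' ks where hs': "hs' = h' # ks" by (cases hs') auto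
    define q q' y where "q = p \<otimes> ext p h" and "q' = p \<otimes> ext p h'" and "y = node q hs"
    note p = Cons.prems(1)
    have q: "q \<in> carrier G" "q' \<in> carrier G" "y \<in> carrier G"
      using p ext node_closed by (simp_all add: q_def q'_def y_def)
    have y: "y = node q' ks"
      using Cons.prems(3) by (simp add: y_def q_def q'_def hs' node_simps)
    \<comment> \<open>A common descendant \<open>y\<close> would lie in the shadows of both
      siblings, so \<open>gp q q'\<close> would be almost \<open>len q\<close> or
      \<open>len q'\<close>. But the siblings diverge right after \<open>p\<close>; comparing the
      two estimates bounds a leg by exactly \<open>3 * C + 4 * \<delta>\<close>.\<close>
    have "h = h'"
    proof (rule ccontr)
      assume "h \<noteq> h'"
      then have "gp (ext p h) (ext p h') \<le> C" using ext_gp[OF p, of h] by (cases h; cases h') auto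
      moreover have "d q q' = d (ext p h) (ext p h')"
        using d_mult_left[of p] p ext by (simp add: q_def q'_def)
      ultimately have "real (d q q') \<ge> len (ext p h) + len (ext p h') - 2 * C"
        using gp_eq[of "ext p h" "ext p h'"] ext p by simp
      moreover have "gp q y - \<delta> \<le> gp q q' \<or> gp y q' - \<delta> \<le> gp q q'"
        using four_point_cases[of \<one> q y q'] q by simp
      moreover have "gp q y \<ge> len q - e - \<delta>" "gp y q' \<ge> len q' - e - \<delta>"
        using shadow[of q hs] shadow[of q' ks] q y_def y gromov_product_commute[of y q' \<one>] by auto
      moreover have "gp q q' = (real (len q) + real (len q') - real (d q q')) / 2"
        using gp_eq q by simp
      moreover have "real (len q) \<ge> len p + len (ext p h) - 2 * e"
        "real (len q') \<ge> len p + len (ext p h') - 2 * e"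
        "real (len q) \<le> len p + len (ext p h)" "real (len q') \<le> len p + len (ext p h')"
        using len_ext[OF p] len_mult_le[of p "ext p h"] len_mult_le[of p "ext p h'"] ext p
        by (simp_all add: q_def q'_def)
      ultimately have "len (ext p h) \<le> 3 * C + 4 * \<delta> \<or> len (ext p h') \<le> 3 * C + 4 * \<delta>"
        unfolding e_def of_nat_add by argo
      then show False
        using ext(2)[OF p, of h] ext(2)[OF p, of h'] assms(3) by linarith
    qed
    moreover have "hs = ks"
      using Cons.IH[of q ks] Cons.prems q y y_def hs' \<open>h = h'\<close> by (simp add: q_def q'_def)
    ultimately show ?case by (simp add: hs')
  qed simp
  have "2 ^ n \<le> card (ball_at_one (M * n))" for n
  proof -
    let ?W = "{hs :: bool list. length hs = n}"
    have "card ?W = 2 ^ n"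
      using card_lists_length_eq[of "UNIV :: bool set" n] by simp
    moreover have "node \<one> ` ?W \<subseteq> ball_at_one (M * n)"
      using node_len[of \<one>] node_closed by (auto simp: ball_at_one_def)
    moreover have "inj_on (node \<one>) ?W"
      using node_inj[of \<one>] by (auto intro: inj_onI)
    ultimately show ?thesis
      using card_inj_on_le[OF _ _ finite_ball_at_one] by metis
  qed
  then show ?thesis by (rule that)
qed

section \<open>Elements of infinite order\<close>

text \<open>An element of length \<open>2L\<close> splits as \<open>inv a \<otimes> b\<close> with \<open>a\<close> and \<open>b\<close> in opposite
  directions. If both \<open>a\<close> and \<open>b\<close> act like reflections, then \<open>a \<otimes> b\<close> acts like a translation.\<close>

lemma ex_translation:
  assumes "infinite (carrier G)"
  obtains g where "g \<in> carrier G" "L \<le> len g" "gp g (inv g) \<le> 3 * \<delta>"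
proof -
  \<comment> \<open>With \<open>N > 4 * \<delta>\<close>, Gromov products of at least
    \<open>N - \<delta>\<close> exceed \<open>3 * \<delta>\<close> and so are never the minimum in
    the four-point conditions below.\<close>
  define N where "N = L + nat \<lceil>4 * \<delta>\<rceil> + 1"
  have N: "L \<le> N" "4 * \<delta> < N" using delta_nonneg by (auto simp: N_def) linarith
  obtain x where x: "x \<in> carrier G" "len x = N + N"
    using word_sphere_nonempty[OF assms, of "N + N"] by (auto simp: word_sphere_eq)
  obtain a' b where ab: "a' \<in> carrier G" "b \<in> carrier G" "x = a' \<otimes> b" "len a' = N" "len b = N"
    using len_split[OF x] .
  \<comment> \<open>Translating the geodesic from \<open>\<one>\<close> to \<open>x\<close> by
    \<open>a\<close> gives one from \<open>a\<close> through \<open>\<one>\<close> to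
    \<open>b\<close>, hence \<open>gp a b = 0\<close>.\<close>
  define a where "a = inv a'"
  have a: "a \<in> carrier G" "len a = N" "gp a b = 0"
    using ab x by (simp_all add: a_def gp_eq word_dist_def)
  show ?thesis
  proof (cases "gp a (inv a) \<le> 3 * \<delta> \<or> gp b (inv b) \<le> 3 * \<delta>")
    case True
    then show ?thesis using that[of a] that[of b] a ab N by auto
  next
    case False
    \<comment> \<open>Now \<open>a\<close> is close in direction to \<open>inv a\<close>, and
      \<open>b\<close> to \<open>inv b\<close>. As \<open>a\<close> and \<open>b\<close> are
      opposite, so are \<open>inv a\<close> and \<open>b\<close>, and also \<open>a\<close> and
      \<open>inv b\<close>. Therefore \<open>a \<otimes> b\<close> starts along \<open>a\<close> and
      its inverse along \<open>inv b\<close>.\<close>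
    note fp = four_point[of \<one>]
    have 1: "gp (inv a) b \<le> \<delta>" 
      using fp[of a "inv a" b] a ab False delta_nonneg by (auto simp: min_def split: if_splits)
    have 2: "gp a (inv b) \<le> \<delta>"
      using fp[of a "inv b" b] a ab False delta_nonneg gromov_product_commute[of b "inv b" \<one>]
      by (auto simp: min_def split: if_splits)
    define g where "g = a \<otimes> b"
    have g: "g \<in> carrier G" "inv g = inv b \<otimes> inv a"
      using a ab by (simp_all add: g_def inv_mult_group)
    have len_g: "len g \<ge> 2 * real N - 2 * \<delta>"
      using len_mult_eq[of a b] a ab 1 by (simp add: g_def)
    have ag: "gp a g \<ge> N - \<delta>"
      using gp_mult_left[of a b] a ab 1 by (simp add: g_def)
    have bg: "gp (inv b) (inv g) \<ge> N - \<delta>"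
      using gp_mult_left[of "inv b" "inv a"] a ab 2 gromov_product_commute[of b "inv a" \<one>] 1
      by (simp add: g(2))
    have "gp a (inv g) \<le> 2 * \<delta>"
      using fp[of a "inv g" "inv b"] a ab g(1) 2 bg N gromov_product_commute[of "inv b" "inv g" \<one>]
      by (auto simp: min_def split: if_splits)
    then have "gp g (inv g) \<le> 3 * \<delta>"
      using fp[of a g "inv g"] a ab g(1) ag N by (auto simp: min_def split: if_splits)
    moreover have "L \<le> len g"
      using len_g N delta_nonneg by linarith
    ultimately show ?thesis using that g by blast
  qed
qed

text \<open>The claims feed one another: a power that starts along \<open>g\<close> stays away from
  \<open>inv g\<close>, so a further factor \<open>g\<close> on the left cancels at most
  \<open>c + \<delta>\<close>. The product again starts along \<open>g\<close> and is longer by at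
  least \<open>1\<close>.\<close>

lemma powers_of_translation:
  fixes c :: real
  assumes g: "g \<in> carrier G" "gp g (inv g) \<le> c" "2 * c + 3 * \<delta> + 1 \<le> len g"
  shows "gp g (g [^] Suc n) \<ge> len g - c - \<delta> \<and> gp (inv g) (g [^] Suc n) \<le> c + \<delta> \<and> len (g [^] Suc n) > n"
proof -
  have c0: "0 \<le> c" using gromov_product_nonneg[of \<one> g "inv g"] g by simp
  have step: "gp (inv g) (g [^] Suc n) \<le> c + \<delta>" if "gp g (g [^] Suc n) \<ge> len g - c - \<delta>" for n
    using four_point[of \<one> "inv g" "g [^] Suc n" g] g that delta_nonneg c0
      gromov_product_commute[of g "inv g" \<one>] gromov_product_commute[of g "g [^] Suc n" \<one>]
    by (auto simp: min_def simp del: nat_pow_Suc split: if_splits)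
  show ?thesis
  proof (induction n)
    case 0
    have "gp g (g [^] Suc 0) = len g" using g by (simp add: gp_eq)
    then show ?case using step[of 0] g c0 delta_nonneg by simp
  next
    case (Suc n)
    have eq: "g [^] Suc (Suc n) = g \<otimes> g [^] Suc n"
      using g(1) by (rule nat_pow_Suc2)
    have "gp g (g [^] Suc (Suc n)) \<ge> len g - c - \<delta>"
      unfolding eq using gp_mult_left[of g "g [^] Suc n"] Suc g by (simp del: nat_pow_Suc)
    moreover have "real (len (g [^] Suc (Suc n))) = len g + len (g [^] Suc n) - 2 * gp (inv g) (g [^] Suc n)"
      unfolding eq using len_mult_eq[of g "g [^] Suc n"] g by (simp del: nat_pow_Suc)
    then have "real (len (g [^] Suc (Suc n))) \<ge> len (g [^] Suc n) + 1"
      using Suc g delta_nonneg by linarith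
    ultimately show ?case using step[of "Suc n"] Suc by linarith
  qed
qed

text \<open>The negative power starts along \<open>inv g\<close> while the positive one stays away
  from \<open>inv g\<close>, so the four-point condition separates them.\<close>

lemma opposite_powers_of_translation:
  fixes c :: real
  assumes g: "g \<in> carrier G" "gp g (inv g) \<le> c" "2 * c + 3 * \<delta> + 1 \<le> len g"
  shows "gp (g [^] Suc n) (inv g [^] Suc m) \<le> c + 2 * \<delta>"
proof -
  have "gp (inv g) (inv (inv g)) \<le> c"
    using g gromov_product_commute[of g "inv g" \<one>] by simp
  then have "gp (inv g) (inv g [^] Suc m) \<ge> len g - c - \<delta>"
    using powers_of_translation[of "inv g" c m] g by simp
  moreover have "gp (inv g) (g [^] Suc n) \<le> c + \<delta>"
    using powers_of_translation[OF g] by blast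
  ultimately show ?thesis
    using four_point[of \<one> "inv g" "inv g [^] Suc m" "g [^] Suc n"] g
      gromov_product_commute[of "g [^] Suc n" "inv g [^] Suc m" \<one>]
    by (auto simp: min_def simp del: nat_pow_Suc split: if_splits)
qed

text \<open>If \<open>x\<close> followed the power for longer than \<open>len g\<close>, it would
  follow \<open>g\<close> for more than half of \<open>len g\<close> and be closer to
  \<open>g\<close> than to \<open>\<one>\<close>.\<close>

lemma gp_power_le_of_nearest:
  fixes c :: real
  assumes g: "g \<in> carrier G" "gp g (inv g) \<le> c" "2 * c + 4 * \<delta> + 1 \<le> len g"
    and x: "x \<in> carrier G" "len x \<le> d g x"
  shows "gp x (g [^] Suc n) \<le> len g"
proof (rule ccontr)
  assume "\<not> ?thesis"
  moreover have "gp g (g [^] Suc n) \<ge> len g - c - \<delta>"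
    using powers_of_translation[of g c n] g delta_nonneg by simp
  ultimately have "gp x g \<ge> len g - c - 2 * \<delta>"
    using four_point[of \<one> x "g [^] Suc n" g] g x delta_nonneg
      gromov_product_nonneg[of \<one> g "inv g"]
      gromov_product_commute[of g "g [^] Suc n" \<one>]
    by (auto simp: min_def simp del: nat_pow_Suc split: if_splits)
  moreover have "gp x g = (real (len x) + real (len g) - real (d g x)) / 2"
    using g x d_commute[of x g] by (simp add: gp_eq)
  ultimately show False using x g by (simp add: field_simps)
qed

lemma ex_tripod:
  assumes "\<not> elementary_group G"
  obtains C a b c where "tripod C (3 * C + 4 * \<delta>) a b c" "0 \<le> C"
proof -
  have inf: "infinite (carrier G)" using assms by (simp add: elementary_group_def)
  \<comment> \<open>The length \<open>10 * \<delta> + 1\<close> is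
    \<open>2 * c + 4 * \<delta> + 1\<close> for \<open>c = 3 * \<delta>\<close>, the strongest
    requirement of the lemmas on powers.\<close>
  obtain g where g: "g \<in> carrier G" "nat \<lceil>10 * \<delta>\<rceil> + 1 \<le> len g" "gp g (inv g) \<le> 3 * \<delta>"
    using ex_translation[OF inf] .
  have lg: "10 * \<delta> + 1 \<le> len g" using g(2) by linarith
  define C where "C = real (len g)"
  define R where "R = 3 * C + 4 * \<delta>"
  define r where "r = nat \<lceil>R\<rceil> + 1"
  have r: "R < real r" by (simp add: r_def) linarith
  \<comment> \<open>Otherwise every right coset of the cyclic subgroup would meet the finite ball
    \<open>ball_at_one r\<close>, and its index would be finite.\<close>
  have "\<exists>x\<in>carrier G. \<forall>k::int. r \<le> d (g [^] k) x"
  proof (rule ccontr)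
    assume "\<not> ?thesis"
    then have near: "\<exists>k::int. d (g [^] k) x < r" if "x \<in> carrier G" for x
      using that by (meson not_le)
    have "rcosets (generate G {g}) \<subseteq> (\<lambda>b. generate G {g} #> b) ` ball_at_one r"
    proof
      fix H assume "H \<in> rcosets (generate G {g})"
      then obtain x where x: "x \<in> carrier G" "H = generate G {g} #> x"
        by (auto simp: RCOSETS_def)
      obtain k :: int where k: "d (g [^] k) x < r" using near[OF x(1)] by blast
      define b where "b = inv (g [^] k) \<otimes> x"
      have b: "b \<in> ball_at_one r" "x = g [^] k \<otimes> b"
        using k g x by (simp_all add: b_def ball_at_one_def word_dist_def)
      have sub: "subgroup (generate G {g}) G" using g by (intro generate_is_subgroup) auto
      have "g [^] k \<in> generate G {g}" using generate_pow[OF g(1)] by blast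
      then have "b \<in> generate G {g} #> x"
        using sub subgroup.m_inv_closed[OF sub] by (auto simp: r_coset_def b_def)
      then have "H = generate G {g} #> b"
        using repr_independence[OF _ x(1) sub] x(2) by simp
      then show "H \<in> (\<lambda>b. generate G {g} #> b) ` ball_at_one r"
        using b by blast
    qed
    then have "finite (rcosets (generate G {g}))"
      using finite_ball_at_one by (meson finite_imageI finite_subset)
    then show False using assms g(1) by (auto simp: elementary_group_def)
  qed
  then obtain y where y: "y \<in> carrier G" "\<And>k::int. r \<le> d (g [^] k) y" by blast
  \<comment> \<open>Translate a power of \<open>g\<close> nearest to \<open>y\<close> to
    \<open>\<one>\<close>. Then no point of the orbit is nearer to \<open>x\<close> than
    \<open>\<one>\<close>, as \<open>gp_power_le_of_nearest\<close> requires for both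
    \<open>g\<close> and \<open>inv g\<close>.\<close>
  obtain k :: int where k: "\<And>j::int. d (g [^] k) y \<le> d (g [^] j) y"
    using ex_has_least_nat[of "\<lambda>_. True" _ "\<lambda>j::int. d (g [^] j) y"] by auto
  define x where "x = inv (g [^] k) \<otimes> y"
  have x: "x \<in> carrier G" using g y by (simp add: x_def)
  have dx: "d (g [^] j) x = d (g [^] (k + j)) y" for j :: int
    using d_mult_left[of "g [^] k" "g [^] j" x] g x y by (simp add: x_def int_pow_mult)
  have len_x: "len x = d (g [^] k) y"
    by (simp add: x_def word_dist_def)
  have near: "len x \<le> d g x" "len x \<le> d (inv g) x"
    using dx[of 1] dx[of "-1"] k g by (simp_all add: len_x int_pow_neg)
  define a b where "a = g [^] Suc r" and "b = inv g [^] Suc r"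
  have c0: "0 \<le> 3 * \<delta>" using delta_nonneg by simp
  have gi: "inv g \<in> carrier G" "gp (inv g) (inv (inv g)) \<le> 3 * \<delta>" "len (inv g) = len g"
    using g gromov_product_commute[of g "inv g" \<one>] by simp_all
  have "gp x a \<le> C" "gp x b \<le> C"
    using gp_power_le_of_nearest[OF g(1,3) _ x near(1), of r] gp_power_le_of_nearest[OF gi(1,2) _ x near(2), of r] lg gi(3)
    by (simp_all add: a_def b_def C_def del: nat_pow_Suc)
  moreover have "gp a b \<le> C"
    using opposite_powers_of_translation[OF g(1,3), of r r] lg c0 by (simp add: a_def b_def C_def del: nat_pow_Suc)
  moreover have "r < len a" "r < len b"
    using powers_of_translation[OF g(1,3), of r] powers_of_translation[OF gi(1,2), of r] lg c0 gi(3)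
    by (simp_all add: a_def b_def del: nat_pow_Suc)
  moreover have "real r \<le> len x" using y(2)[of k] len_x by simp
  moreover have "{x, a, b} \<subseteq> carrier G" using x g by (auto simp: a_def b_def simp del: nat_pow_Suc)
  ultimately have "tripod C R x a b" using r unfolding tripod_def by auto
  then show ?thesis using that[of C x a b] by (simp add: R_def C_def)
qed

lemma exponential_ball_growth:
  assumes "\<not> elementary_group G"
  obtains M where "\<And>n. 2 ^ n \<le> card (ball_at_one (M * n))"
  using ex_tripod[OF assms] exponential_ball_of_tripod by (metis order_refl)

end

section \<open>Slim triangles of vertices\<close>

context word_metric
begin

text \<open>The point at distance \<open>s\<close> from \<open>x\<close> on the geodesic \<open>w\<close> of the Cayley graph from \<open>x\<close> to \<open>y\<close>:
  the barycentric coordinate of a vertex \<open>w k\<close> is \<open>1 - \<bar>s - k\<bar>\<close>, truncated at \<open>0\<close>.\<close>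

definition tent :: "(nat \<Rightarrow> 'a) \<Rightarrow> 'a \<Rightarrow> 'a \<Rightarrow> real \<Rightarrow> 'a \<Rightarrow> real" where
  "tent w x y s v = (if v \<in> w ` {..d x y} then max 0 (1 - \<bar>s - real (d x v)\<bar>) else 0)"

lemma tent_vertex:
  assumes "geodesic w x y" "k \<le> d x y"
  shows "tent w x y s (w k) = max 0 (1 - \<bar>s - real k\<bar>)"
  using geodesic_ends(2)[OF assms] assms(2) by (simp add: tent_def)

lemma bary_supp_tent:
  fixes s :: real
  assumes "geodesic w x y"
  shows "bary_supp (tent w x y s) = w ` {k. k \<le> d x y \<and> \<bar>s - real k\<bar> < 1}"
proof (rule Set.set_eqI)
  fix v
  show "v \<in> bary_supp (tent w x y s) \<longleftrightarrow> v \<in> w ` {k. k \<le> d x y \<and> \<bar>s - real k\<bar> < 1}"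
  proof (cases "v \<in> w ` {..d x y}")
    case True
    then obtain k where k: "k \<le> d x y" "v = w k" by auto
    have "v \<in> bary_supp (tent w x y s) \<longleftrightarrow> \<bar>s - real k\<bar> < 1"
      unfolding bary_supp_def mem_Collect_eq k(2) tent_vertex[OF assms k(1)] by linarith
    moreover have "v \<in> w ` {k. k \<le> d x y \<and> \<bar>s - real k\<bar> < 1} \<longleftrightarrow> \<bar>s - real k\<bar> < 1"
      unfolding k(2) using k(1) geodesic_inj[OF assms k(1)] by auto
    ultimately show ?thesis by (simp only:)
  next
    case False
    then show ?thesis by (auto simp: bary_supp_def tent_def)
  qed
qed

lemma tent_in_cayley_graph:
  fixes s :: real
  assumes w: "geodesic w x y" and s: "0 \<le> s" "s \<le> d x y"
  shows "tent w x y s \<in> cayley_graph G S"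
proof -
  define i where "i = nat \<lfloor>s\<rfloor>"
  define t where "t = s - i"
  have i: "real i \<le> s" "s < i + 1" "i \<le> d x y"
    using s unfolding i_def by linarith+
  have t: "t \<in> {0..1}" using i by (simp add: t_def)
  \<comment> \<open>At the end of the geodesic there is no next vertex; the edge degenerates there,
    with \<open>t = 0\<close>.\<close>
  define j where "j = (if i = d x y then i else Suc i)"
  have j: "j \<le> d x y" "i \<le> j" "j \<le> Suc i" using i by (auto simp: j_def)
  have ij: "w i \<in> carrier G" "w j \<in> carrier G" "d (w i) (w j) \<le> 1"
    using w i(3) j unfolding geodesic_def by auto
  have "tent w x y s v = (1 - t) * of_bool (v = w i) + t * of_bool (v = w j)" for v
  proof (cases "v \<in> w ` {..d x y}")
    case True
    then obtain k where k: "k \<le> d x y" "v = w k" by auto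
    have eq: "v = w i \<longleftrightarrow> k = i" "v = w j \<longleftrightarrow> k = j"
      unfolding k(2) using geodesic_inj[OF w k(1) i(3)] geodesic_inj[OF w k(1) j(1)] by auto
    have tk: "tent w x y s v = max 0 (1 - \<bar>s - real k\<bar>)"
      using tent_vertex[OF w k(1)] k(2) by simp
    have rhs: "(1 - t) * of_bool (v = w i) + t * of_bool (v = w j) = (1 - t) * of_bool (k = i) + t * of_bool (k = j)"
      by (simp only: eq)
    consider "k < i" | "k = i" | "k = Suc i" | "Suc i < k" by linarith
    then show ?thesis
    proof cases
      case 1
      then have "\<bar>s - real k\<bar> \<ge> 1" "k \<noteq> i" "k \<noteq> j" using i j by linarith+
      then show ?thesis unfolding rhs tk by simp
    next
      case 2
      show ?thesis
      proof (cases "i = d x y")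
        case True
        then have "t = 0" using i s by (simp add: t_def)
        then show ?thesis unfolding rhs tk using 2 by (simp add: t_def j_def True)
      next
        case False
        then have "j = Suc i" by (simp add: j_def)
        then show ?thesis unfolding rhs tk using 2 i by (simp add: t_def)
      qed
    next
      case 3
      then have "j = Suc i" using k by (simp add: j_def)
      then show ?thesis unfolding rhs tk using 3 i by (simp add: t_def)
    next
      case 4
      then have "\<bar>s - real k\<bar> \<ge> 1" "k \<noteq> i" "k \<noteq> j" using i j by linarith+
      then show ?thesis unfolding rhs tk by simp
    qed
  next
    case False
    then show ?thesis using i j by (auto simp: tent_def)
  qed
  then have "tent w x y s = (\<lambda>v. (1 - t) * of_bool (v = w i) + t * of_bool (v = w j))" by blast
  then show ?thesis using ij t unfolding cayley_graph_def by blast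
qed

text \<open>On a common edge both coordinates change by \<open>\<bar>s - t\<bar>\<close>, and the
  definition halves the sum. Otherwise the candidates are lengths of detours through integer points
  \<open>k\<close> and \<open>l\<close>; the least is attained by rounding \<open>s\<close> and
  \<open>t\<close> towards each other.\<close>

lemma cayley_dist_tent:
  fixes s t :: real
  assumes w: "geodesic w x y"
    and s: "0 \<le> s" "s \<le> d x y" and t: "0 \<le> t" "t \<le> d x y"
  shows "cayley_dist G S (tent w x y s) (tent w x y t) = \<bar>s - t\<bar>"
proof -
  define I where "I = (\<lambda>s :: real. {k. k \<le> d x y \<and> \<bar>s - real k\<bar> < 1})"
  have fin: "finite (I s)" for s by (rule finite_subset[of _ "{..d x y}"]) (auto simp: I_def)
  have supp: "bary_supp (tent w x y s) = w ` I s" for s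
    using bary_supp_tent[OF w] by (simp add: I_def)
  have inj: "inj_on w {..d x y}" using geodesic_inj[OF w] by (auto intro: inj_onI)
  have I_sub: "I s \<subseteq> {..d x y}" for s by (auto simp: I_def)
  have vertex: "tent w x y s (w k) = 1 - \<bar>s - real k\<bar>" if "k \<in> I s" for s k
    using tent_vertex[OF w, of k s] that by (simp add: I_def)
  have ceil_in: "nat \<lceil>s\<rceil> \<in> I s" and floor_in: "nat \<lfloor>s\<rfloor> \<in> I s" if "0 \<le> s" "s \<le> d x y" for s :: real
  proof -
    have "real (nat \<lfloor>s\<rfloor>) \<le> s" "s < real (nat \<lfloor>s\<rfloor>) + 1" "s \<le> real (nat \<lceil>s\<rceil>)" "real (nat \<lceil>s\<rceil>) < s + 1"
      "nat \<lceil>s\<rceil> \<le> d x y"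
      using that by linarith+
    then show "nat \<lceil>s\<rceil> \<in> I s" "nat \<lfloor>s\<rfloor> \<in> I s"
      using that(2) unfolding I_def mem_Collect_eq by linarith+
  qed
  show ?thesis
  proof (cases "w ` I s = w ` I t")
    case True
    then have eq: "I s = I t" using inj_on_image_eq_iff[OF inj I_sub I_sub] by blast
    have dist: "cayley_dist G S (tent w x y s) (tent w x y t)
        = (\<Sum>k\<in>I s. \<bar>\<bar>t - real k\<bar> - \<bar>s - real k\<bar>\<bar>) / 2"
    proof -
      have "cayley_dist G S (tent w x y s) (tent w x y t)
          = (\<Sum>v\<in>w ` I s. \<bar>tent w x y s v - tent w x y t v\<bar>) / 2"
        using True supp by (simp add: cayley_dist_def)
      also have "\<dots> = (\<Sum>k\<in>I s. \<bar>tent w x y s (w k) - tent w x y t (w k)\<bar>) / 2"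
        using inj_on_subset[OF inj I_sub] by (simp add: sum.reindex)
      also have "(\<Sum>k\<in>I s. \<bar>tent w x y s (w k) - tent w x y t (w k)\<bar>)
          = (\<Sum>k\<in>I s. \<bar>\<bar>t - real k\<bar> - \<bar>s - real k\<bar>\<bar>)"
        using eq by (intro sum.cong) (auto simp: vertex)
      finally show ?thesis .
    qed
    define i where "i = nat \<lfloor>s\<rfloor>"
    have i: "i \<in> I s" "real i \<le> s" "s < real i + 1" "i \<in> I t"
      using floor_in[OF s] s eq unfolding i_def by (simp, linarith, linarith, simp)
    have mem: "k \<in> I s \<longleftrightarrow> k \<le> d x y \<and> \<bar>s - real k\<bar> < 1"
      "k \<in> I s \<longleftrightarrow> k \<le> d x y \<and> \<bar>t - real k\<bar> < 1" for k
      using eq by (auto simp: I_def)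
    show ?thesis
    proof (cases "s = real i")
      case True
      have "t = real i"
      proof (rule ccontr)
        assume "t \<noteq> real i"
        then consider "t < real i" | "t > real i" by linarith
        then show False
        proof cases
          case 1
          then have "i - 1 \<in> I t" "i \<ge> 1" using t i by (auto simp: I_def of_nat_diff)
          then show False using mem(1)[of "i - 1"] eq True by (auto simp: of_nat_diff)
        next
          case 2
          then have "Suc i \<in> I t" using t i by (auto simp: I_def)
          then show False using mem(1)[of "Suc i"] eq True by auto
        qed
      qed
      then show ?thesis using dist True by simp
    next
      case False
      then have si: "real i < s" using i by simp
      then have "Suc i \<in> I s" using s i by (auto simp: I_def)
      moreover have Is: "I s = {i, Suc i}"
        using i si s by (auto simp: I_def)
      ultimately have "\<bar>t - real i\<bar> < 1" "\<bar>t - real (Suc i)\<bar> < 1"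
        using mem(2)[of i] mem(2)[of "Suc i"] i(1) by blast+
      then have "real i < t" "t < real i + 1" by auto
      then have "\<bar>t - real i\<bar> - \<bar>s - real i\<bar> = t - s" "\<bar>t - real (Suc i)\<bar> - \<bar>s - real (Suc i)\<bar> = s - t"
        using si i(3) by auto
      then show ?thesis using dist unfolding Is by simp
    qed
  next
    case False
    let ?f = "\<lambda>(u, v). (1 - tent w x y s u) + real (d u v) + (1 - tent w x y t v)"
    have d_eq: "real (d (w k) (w l)) = \<bar>real k - real l\<bar>" if "k \<le> d x y" "l \<le> d x y" for k l
      using w that unfolding geodesic_def by auto
    have f_eq: "?f (w k, w l) = \<bar>s - real k\<bar> + \<bar>real k - real l\<bar> + \<bar>t - real l\<bar>"
      if "k \<in> I s" "l \<in> I t" for k l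
      using that d_eq[of k l] I_sub by (auto simp: vertex)
    have "\<exists>k\<in>I s. \<exists>l\<in>I t. \<bar>s - real k\<bar> + \<bar>real k - real l\<bar> + \<bar>t - real l\<bar> = \<bar>s - t\<bar>"
    proof -
      have "s \<noteq> t" using False by auto
      \<comment> \<open>The support changes only on reaching or leaving an integer, so different
        supports guarantee an integer between the two parameters.\<close>
      have same: "I a = I b" if "a \<le> b" "b < \<lceil>a\<rceil>" "0 \<le> a" for a b :: real
      proof -
        have "\<bar>a - real k\<bar> < 1 \<longleftrightarrow> \<bar>b - real k\<bar> < 1" for k
        proof -
          have "\<bar>z - real k\<bar> < 1 \<longleftrightarrow> real k = \<lceil>a\<rceil> \<or> real k = \<lceil>a\<rceil> - 1"
            if "a \<le> z" "z \<le> b" for z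
          proof -
            have "\<lceil>a\<rceil> - 1 < z" "z < \<lceil>a\<rceil>" using that \<open>b < \<lceil>a\<rceil>\<close> by linarith+
            then have "\<bar>z - real k\<bar> < 1 \<longleftrightarrow> int k = \<lceil>a\<rceil> \<or> int k = \<lceil>a\<rceil> - 1" by linarith
            then show ?thesis by linarith
          qed
          then show ?thesis using that(1) by (metis order_refl)
        qed
        then show ?thesis by (simp add: I_def)
      qed
      have pair: "\<bar>a - real (nat \<lceil>a\<rceil>)\<bar> + \<bar>real (nat \<lceil>a\<rceil>) - real (nat \<lfloor>b\<rfloor>)\<bar> + \<bar>b - real (nat \<lfloor>b\<rfloor>)\<bar> = \<bar>a - b\<bar>"
        if "a \<le> b" "\<lceil>a\<rceil> \<le> b" "0 \<le> a" for a b :: real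
      proof -
        have between: "\<bar>a - A\<bar> + \<bar>A - B\<bar> + \<bar>b - B\<bar> = \<bar>a - b\<bar>" if "a \<le> A" "A \<le> B" "B \<le> b" for A B
          using that by simp
        have "\<lceil>a\<rceil> \<le> \<lfloor>b\<rfloor>" using that by linarith
        then have "a \<le> real (nat \<lceil>a\<rceil>)" "real (nat \<lceil>a\<rceil>) \<le> real (nat \<lfloor>b\<rfloor>)" "real (nat \<lfloor>b\<rfloor>) \<le> b"
          using that by linarith+
        then show ?thesis by (rule between)
      qed
      show ?thesis
      proof (cases "s \<le> t")
        case True
        then have "\<lceil>s\<rceil> \<le> t" using same[of s t] s False by force
        then show ?thesis using pair[of s t] True s t ceil_in floor_in by blast
      next
        case False2: False
        then have "\<lceil>t\<rceil> \<le> s" using same[of t s] t False by force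
        then have "\<bar>s - real (nat \<lfloor>s\<rfloor>)\<bar> + \<bar>real (nat \<lfloor>s\<rfloor>) - real (nat \<lceil>t\<rceil>)\<bar> + \<bar>t - real (nat \<lceil>t\<rceil>)\<bar> = \<bar>s - t\<bar>"
          using pair[of t s] False2 t by (simp add: abs_minus_commute add.commute add.left_commute)
        then show ?thesis using s t ceil_in floor_in by blast
      qed
    qed
    then obtain k l where kl: "k \<in> I s" "l \<in> I t"
      "\<bar>s - real k\<bar> + \<bar>real k - real l\<bar> + \<bar>t - real l\<bar> = \<bar>s - t\<bar>" by blast
    have "Min (?f ` (w ` I s \<times> w ` I t)) = \<bar>s - t\<bar>"
    proof (rule Min_eqI)
      show "finite (?f ` (w ` I s \<times> w ` I t))" using fin by blast
      show "\<bar>s - t\<bar> \<le> z" if "z \<in> ?f ` (w ` I s \<times> w ` I t)" for z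
      proof -
        obtain k l where "k \<in> I s" "l \<in> I t" "z = ?f (w k, w l)" using \<open>z \<in> _\<close> by auto
        then show ?thesis using f_eq by auto
      qed
      show "\<bar>s - t\<bar> \<in> ?f ` (w ` I s \<times> w ` I t)"
        using kl f_eq[OF kl(1,2)] by (intro image_eqI[of _ _ "(w k, w l)"]) auto
    qed
    then show ?thesis using False supp by (simp add: cayley_dist_def)
  qed
qed

lemma geodesic_segment_tent:
  assumes "geodesic w x y"
  shows "geodesic_segment (cayley_graph G S) (cayley_dist G S) (tent w x y 0) (tent w x y (d x y))
    (tent w x y ` {0..real (d x y)})"
  unfolding geodesic_segment_def
  using tent_in_cayley_graph[OF assms] cayley_dist_tent[OF assms]
  by (intro exI[of _ "real (d x y)"] exI[of _ "tent w x y"] conjI) auto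

lemma tent_ends:
  assumes "geodesic w x y"
  shows "tent w x y 0 = (\<lambda>v. of_bool (v = x))" "tent w x y (d x y) = (\<lambda>v. of_bool (v = y))"
proof -
  have *: "tent w x y (real k) = (\<lambda>v. of_bool (v = w k))" if "k \<le> d x y" for k
  proof
    fix v
    show "tent w x y (real k) v = of_bool (v = w k)"
    proof (cases "v \<in> w ` {..d x y}")
      case True
      then obtain l where l: "l \<le> d x y" "v = w l" by auto
      have "v = w k \<longleftrightarrow> l = k" using geodesic_inj[OF assms l(1) that] l(2) by auto
      then show ?thesis using tent_vertex[OF assms l(1)] l(2) by auto
    next
      case False
      then show ?thesis using that by (auto simp: tent_def)
    qed
  qed
  have "w 0 = x" "w (d x y) = y" using assms by (auto simp only: geodesic_def)
  then show "tent w x y 0 = (\<lambda>v. of_bool (v = x))" "tent w x y (d x y) = (\<lambda>v. of_bool (v = y))"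
    using *[of 0] *[of "d x y"] by simp_all
qed

text \<open>The minimum in \<open>cayley_dist\<close> is attained at some vertex \<open>u l\<close>
  of the second support, and dropping the part of the path inside the edge only shortens it. The
  bound \<open>0\<close> covers equal supports, where \<open>w k\<close> is itself a vertex of
  \<open>u\<close>.\<close>

lemma near_vertex:
  fixes t D :: real
  assumes w: "geodesic w x y" "k \<le> d x y" and u: "geodesic u z z'"
    and t: "0 \<le> t" "t \<le> d z z'"
    and near: "cayley_dist G S (tent w x y k) (tent u z z' t) \<le> D"
  shows "\<exists>l\<le>d z z'. d (w k) (u l) \<le> max D 0"
proof -
  have "{l. l \<le> d x y \<and> \<bar>real k - real l\<bar> < 1} = {k}"
    using w(2) by auto
  then have supp_w: "bary_supp (tent w x y k) = {w k}"
    using bary_supp_tent[OF w(1), of "real k"] by simp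
  have wk: "tent w x y k (w k) = 1" using tent_vertex[OF w, of "real k"] by simp
  let ?I = "{l. l \<le> d z z' \<and> \<bar>t - real l\<bar> < 1}"
  have supp_u: "bary_supp (tent u z z' t) = u ` ?I"
    using bary_supp_tent[OF u] .
  show ?thesis
  proof (cases "bary_supp (tent w x y k) = bary_supp (tent u z z' t)")
    case True
    then have "w k \<in> u ` ?I" using supp_w supp_u by blast
    then obtain l where "l \<le> d z z'" "w k = u l" by blast
    then show ?thesis using geodesic_ends(1)[OF u] by (intro exI[of _ l]) auto
  next
    case False
    let ?f = "\<lambda>(a, b). (1 - tent w x y k a) + real (d a b) + (1 - tent u z z' t b)"
    let ?A = "?f ` ({w k} \<times> u ` ?I)"
    have eq: "cayley_dist G S (tent w x y k) (tent u z z' t) = Min ?A"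
      using False supp_w supp_u by (simp add: cayley_dist_def)
    have fin: "finite ?A" by auto
    have "nat \<lfloor>t\<rfloor> \<in> ?I"
      using t unfolding mem_Collect_eq abs_less_iff by linarith
    then have "?A \<noteq> {}" by blast
    then obtain l where l: "l \<in> ?I" "Min ?A = ?f (w k, u l)"
        using Min_in[OF fin] by fastforce
      have "tent u z z' t (u l) \<le> 1" using tent_vertex[OF u, of l t] l(1) by simp
      then have "real (d (w k) (u l)) \<le> D" using near eq l(2) wk by simp
      then show ?thesis using l(1) by auto
  qed
qed

lemma slim_triangle:
  assumes hyp: "delta_hyperbolic (cayley_graph G S) (cayley_dist G S) \<delta>"
    and w: "geodesic w x y" "geodesic w' y z" "geodesic w'' z x" and k: "k \<le> d x y"
  shows "(\<exists>l\<le>d y z. real (d (w k) (w' l)) \<le> max \<delta> 0) \<or> (\<exists>l\<le>d z x. real (d (w k) (w'' l)) \<le> max \<delta> 0)"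
proof -
  let ?seg = "geodesic_segment (cayley_graph G S) (cayley_dist G S)"
  let ?v = "\<lambda>x v. of_bool (v = x) :: real"
  have seg: "?seg (?v x) (?v y) (tent w x y ` {0..real (d x y)})" if "geodesic w x y" for w x y
    using geodesic_segment_tent[OF that] unfolding tent_ends[OF that] .
  have slim: "\<exists>q\<in>B \<union> C. cayley_dist G S p q \<le> \<delta>"
    if "?seg a b A" "?seg b c B" "?seg c a C" "p \<in> A" for a b c A B C p
    using hyp that unfolding delta_hyperbolic_def by meson
  have "tent w x y k \<in> tent w x y ` {0..real (d x y)}" using k by auto
  then have "\<exists>q\<in>tent w' y z ` {0..real (d y z)} \<union> tent w'' z x ` {0..real (d z x)}.
      cayley_dist G S (tent w x y k) q \<le> \<delta>"
    by (rule slim[OF seg[OF w(1)] seg[OF w(2)] seg[OF w(3)]])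
  then consider t :: real where "0 \<le> t" "t \<le> d y z" "cayley_dist G S (tent w x y k) (tent w' y z t) \<le> \<delta>"
    | t :: real where "0 \<le> t" "t \<le> d z x" "cayley_dist G S (tent w x y k) (tent w'' z x t) \<le> \<delta>"
    by fastforce
  then show ?thesis
    using near_vertex[OF w(1) k w(2)] near_vertex[OF w(1) k w(3)] by cases blast+
qed

text \<open>The Gromov product \<open>gromov_product p x y\<close> agrees with the distance from \<open>p\<close> to a geodesic
  from \<open>x\<close> to \<open>y\<close> up to an additive constant, so the four-point condition says that the side
  from \<open>x\<close> to \<open>z\<close> of a triangle is close to the other two.\<close>

lemma gromov_product_le_dist_geodesic:
  assumes "geodesic w x y" "k \<le> d x y" "p \<in> carrier G" "x \<in> carrier G" "y \<in> carrier G"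
  shows "gromov_product p x y \<le> d p (w k)"
  using geodesic_ends[OF assms(1,2)] assms d_triangle[of p "w k" x] d_triangle[of p "w k" y]
    d_commute[of x "w k"]
  by (simp add: gromov_product_def)

text \<open>Take the last vertex of \<open>w\<close> close to the side from \<open>p\<close> to
  \<open>x\<close>. Its successor, if any, is close to the other side, hence so is the vertex up to
  \<open>1\<close>. A detour through it is then nearly as short as either side at
  \<open>p\<close>.\<close>

lemma dist_geodesic_le_gromov_product:
  assumes hyp: "delta_hyperbolic (cayley_graph G S) (cayley_dist G S) \<delta>"
    and w: "geodesic w x y" and xyp: "x \<in> carrier G" "y \<in> carrier G" "p \<in> carrier G"
  obtains k where "k \<le> d x y" "d p (w k) \<le> gromov_product p x y + 2 * max \<delta> 0 + 2"
proof -
  obtain u where u: "geodesic u y p" using ex_geodesic xyp by blast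
  obtain v where v: "geodesic v p x" using ex_geodesic xyp by blast
  define D where "D = max \<delta> 0"
  define P where "P = (\<lambda>k. \<exists>l\<le>d p x. real (d (w k) (v l)) \<le> D)"
  define Q where "Q = (\<lambda>k. \<exists>l\<le>d y p. real (d (w k) (u l)) \<le> D + 1)"
  have closed: "w k \<in> carrier G" if "k \<le> d x y" for k using geodesic_ends(1)[OF w that] .
  have ends: "w 0 = x" "w (d x y) = y" "u 0 = y" "v (d p x) = x"
    using w u v by (auto simp only: geodesic_def)
  have "P 0" unfolding P_def using ends xyp by (intro exI[of _ "d p x"]) (simp add: D_def)
  define k where "k = (GREATEST k. k \<le> d x y \<and> P k)"
  have k: "k \<le> d x y \<and> P k"
    unfolding k_def by (rule GreatestI_nat[of _ 0 "d x y"]) (use \<open>P 0\<close> in auto)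
  have "Q k"
  proof (cases "k = d x y")
    case True
    then show ?thesis unfolding Q_def using ends xyp by (intro exI[of _ 0]) (simp add: D_def)
  next
    case False
    then have k1: "Suc k \<le> d x y" using k by simp
    then have "\<not> P (Suc k)"
      using Greatest_le_nat[of "\<lambda>k. k \<le> d x y \<and> P k" "Suc k" "d x y"] unfolding k_def[symmetric] by auto
    then obtain l where l: "l \<le> d y p" "real (d (w (Suc k)) (u l)) \<le> D"
      using slim_triangle[OF hyp w u v k1] unfolding P_def D_def by blast
    have "d (w k) (w (Suc k)) = 1" using w k k1 unfolding geodesic_def by auto
    then have "real (d (w k) (u l)) \<le> D + 1"
      using d_triangle[of "w k" "w (Suc k)" "u l"] closed[of k] closed[of "Suc k"] k1
        geodesic_ends(1)[OF u l(1)] l(2) by simp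
    then show ?thesis using l(1) unfolding Q_def by blast
  qed
  then obtain l where l: "l \<le> d y p" "real (d (w k) (u l)) \<le> D + 1" unfolding Q_def by blast
  obtain m where m: "m \<le> d p x" "real (d (w k) (v m)) \<le> D" using k unfolding P_def by blast
  have wk: "w k \<in> carrier G" using closed k by blast
  note um = geodesic_ends[OF u l(1)] and vm = geodesic_ends[OF v m(1)] and wm = geodesic_ends[OF w conjunct1[OF k]]
  have "real (d p (w k)) + d (w k) y \<le> d p y + 2 * (D + 1)"
    using d_triangle[of p "u l" "w k"] d_triangle[of "w k" "u l" y] um wk xyp l
      d_commute[of p "u l"] d_commute[of "w k" "u l"] d_commute[of p y] d_commute[of "u l" y] by simp
  moreover have "real (d p (w k)) + d x (w k) \<le> d p x + 2 * D"
    using d_triangle[of p "v m" "w k"] d_triangle[of x "v m" "w k"] vm wk xyp m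
      d_commute[of "w k" "v m"] d_commute[of x "v m"] by simp
  moreover have "real (d x y) = real (d x (w k)) + d (w k) y" using wm k by simp
  ultimately have "d p (w k) \<le> gromov_product p x y + 2 * D + 2"
    by (simp add: gromov_product_def field_simps)
  then show ?thesis using that k unfolding D_def by blast
qed

text \<open>Take a point on the side from \<open>x\<close> to \<open>z\<close> that nearly realizes
  the Gromov product. Slimness moves it to another side at a cost of \<open>max \<delta> 0\<close>,
  where its distance from \<open>p\<close> bounds the Gromov product of that side.\<close>

lemma hyperbolic_word_metric_of_slim:
  assumes hyp: "delta_hyperbolic (cayley_graph G S) (cayley_dist G S) \<delta>"
  shows "hyperbolic_word_metric G S (3 * max \<delta> 0 + 2)"
proof
  fix p x y z assume c: "p \<in> carrier G" "x \<in> carrier G" "y \<in> carrier G" "z \<in> carrier G"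
  obtain w where w: "geodesic w x z" using ex_geodesic c by blast
  obtain u where u: "geodesic u z y" using ex_geodesic c by blast
  obtain v where v: "geodesic v y x" using ex_geodesic c by blast
  obtain k where k: "k \<le> d x z" "d p (w k) \<le> gromov_product p x z + 2 * max \<delta> 0 + 2"
    using dist_geodesic_le_gromov_product[OF hyp w] c by blast
  have wk: "w k \<in> carrier G" using geodesic_ends(1)[OF w k(1)] .
  from slim_triangle[OF hyp w u v k(1)]
  show "min (gromov_product p x y) (gromov_product p y z) - (3 * max \<delta> 0 + 2) \<le> gromov_product p x z"
  proof (elim disjE exE conjE)
    fix l assume l: "l \<le> d z y" "real (d (w k) (u l)) \<le> max \<delta> 0"
    have "real (d p (u l)) \<le> d p (w k) + max \<delta> 0"
      using d_triangle[of p "w k" "u l"] c wk geodesic_ends(1)[OF u l(1)] l(2) by simp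
    moreover have "gromov_product p y z \<le> d p (u l)"
      using gromov_product_le_dist_geodesic[OF u l(1)] c gromov_product_commute[of y z p] by simp
    ultimately show ?thesis using k(2) by linarith
  next
    fix l assume l: "l \<le> d y x" "real (d (w k) (v l)) \<le> max \<delta> 0"
    have "real (d p (v l)) \<le> d p (w k) + max \<delta> 0"
      using d_triangle[of p "w k" "v l"] c wk geodesic_ends(1)[OF v l(1)] l(2) by simp
    moreover have "gromov_product p x y \<le> d p (v l)"
      using gromov_product_le_dist_geodesic[OF v l(1)] c gromov_product_commute[of x y p] by simp
    ultimately show ?thesis using k(2) by linarith
  qed
qed

end

section \<open>Geodesics of a second word metric\<close>

context hyperbolic_word_metric
begin

text \<open>Cut the path after \<open>2 ^ k\<close> steps: the four-point condition passes to one of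
  the two pieces at a cost of \<open>\<delta>\<close>. The total cost is thus logarithmic in the
  number of steps.\<close>

lemma gromov_product_path:
  assumes "1 \<le> m" "m \<le> 2 ^ k" "c \<in> carrier G" "\<And>i. i \<le> m \<Longrightarrow> p i \<in> carrier G"
  shows "\<exists>i<m. gromov_product c (p i) (p (Suc i)) - k * \<delta> \<le> gromov_product c (p 0) (p m)"
  using assms
proof (induction k arbitrary: p m)
  case 0
  then have "m = 1" by simp
  then show ?case by auto
next
  case (Suc k)
  show ?case
  proof (cases "m \<le> 2 ^ k")
    case True
    obtain i where "i < m" "gromov_product c (p i) (p (Suc i)) - k * \<delta> \<le> gromov_product c (p 0) (p m)"
      using Suc.IH[of m p] True Suc.prems by auto
    then show ?thesis
      using delta_nonneg by (intro exI[of _ i]) (simp add: field_simps)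
  next
    case False
    define l where "l = (2::nat) ^ k"
    have l: "1 \<le> l" "l < m" "1 \<le> m - l" "m - l \<le> 2 ^ k" using False Suc.prems(2) by (auto simp: l_def)
    obtain i where i: "i < l" "gromov_product c (p i) (p (Suc i)) - k * \<delta> \<le> gromov_product c (p 0) (p l)"
      using Suc.IH[of l p] l Suc.prems by (auto simp: l_def)
    obtain j where j: "j < m - l"
      "gromov_product c (p (l + j)) (p (l + Suc j)) - k * \<delta> \<le> gromov_product c (p l) (p m)"
      using Suc.IH[of "m - l" "\<lambda>i. p (l + i)"] l Suc.prems by auto
    have "gromov_product c (p 0) (p l) - \<delta> \<le> gromov_product c (p 0) (p m)
        \<or> gromov_product c (p l) (p m) - \<delta> \<le> gromov_product c (p 0) (p m)"
      using four_point_cases[of c "p 0" "p l" "p m"] l Suc.prems by simp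
    then show ?thesis
    proof
      assume "gromov_product c (p 0) (p l) - \<delta> \<le> gromov_product c (p 0) (p m)"
      then show ?thesis using i l by (intro exI[of _ i]) (simp add: field_simps)
    next
      assume "gromov_product c (p l) (p m) - \<delta> \<le> gromov_product c (p 0) (p m)"
      then show ?thesis using j l by (intro exI[of _ "l + j"]) (simp add: field_simps)
    qed
  qed
qed

text \<open>A step of length at most \<open>K\<close> has Gromov product at least
  \<open>d c (p i) - K\<close>, so the step found by \<open>gromov_product_path\<close> passes near
  \<open>c\<close>.\<close>

lemma dist_path_le:
  assumes "m \<le> 2 ^ k" "c \<in> carrier G" "\<And>i. i \<le> m \<Longrightarrow> p i \<in> carrier G"
    and step: "\<And>i. i < m \<Longrightarrow> d (p i) (p (Suc i)) \<le> K"
  shows "\<exists>i\<le>m. d c (p i) \<le> gromov_product c (p 0) (p m) + k * \<delta> + K"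
proof (cases "m = 0")
  case True
  have "gromov_product c (p 0) (p 0) = d c (p 0)"
    using assms(3)[of 0] by (simp add: gromov_product_def)
  then show ?thesis using True delta_nonneg by auto
next
  case False
  then obtain i where i: "i < m"
    "gromov_product c (p i) (p (Suc i)) - k * \<delta> \<le> gromov_product c (p 0) (p m)"
    using gromov_product_path[of m k c p] assms by auto
  have "real (d c (p i)) - real (d (p i) (p (Suc i))) \<le> gromov_product c (p i) (p (Suc i))"
    using d_triangle[of c "p (Suc i)" "p i"] d_commute[of "p (Suc i)" "p i"] assms(2,3) i(1)
    by (simp add: gromov_product_def field_simps)
  then show ?thesis
    using i step[OF i(1)] by (intro exI[of _ i]) linarith
qed

text \<open>Put \<open>c\<close> on a geodesic from \<open>x\<close> to \<open>y\<close> where the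
  third side branches off. The product for that side vanishes and the other two differ by at most
  the rounding error \<open>1\<close>; the four-point condition bounds the smaller one by
  \<open>\<delta>\<close>.\<close>

lemma ex_center:
  assumes "x \<in> carrier G" "y \<in> carrier G" "z \<in> carrier G"
  obtains c where "c \<in> carrier G" "gromov_product c x y \<le> \<delta> + 1" "gromov_product c x z \<le> \<delta> + 1"
    "gromov_product c y z \<le> \<delta> + 1"
proof -
  obtain w where w: "geodesic w x y" using ex_geodesic assms by blast
  define k where "k = nat \<lfloor>gromov_product x y z\<rfloor>"
  have gp: "0 \<le> gromov_product x y z" "gromov_product x y z \<le> d x y"
    using gromov_product_nonneg gromov_product_le assms by blast+
  then have k: "k \<le> d x y" "real k \<le> gromov_product x y z" "gromov_product x y z \<le> k + 1"
    unfolding k_def by linarith+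
  define c where "c = w k"
  note c = geodesic_ends[OF w k(1), folded c_def]
  have dc: "real (d c x) = k" "real (d c y) = real (d x y) - k"
    using c k(1) d_commute[of x c] assms by auto
  have "gromov_product c x y = 0" using dc k(1) by (simp add: gromov_product_def)
  moreover have "gromov_product c x z - gromov_product c y z = k - gromov_product x y z"
    using dc by (simp add: gromov_product_def field_simps)
  moreover have "gromov_product c x z - \<delta> \<le> gromov_product c x y \<or> gromov_product c z y - \<delta> \<le> gromov_product c x y"
    using four_point_cases[of c x z y] c assms by blast
  moreover have "gromov_product c z y = gromov_product c y z"
    using gromov_product_commute assms by blast
  ultimately have "gromov_product c x y \<le> \<delta> + 1 \<and> gromov_product c x z \<le> \<delta> + 1 \<and> gromov_product c y z \<le> \<delta> + 1"
    using k delta_nonneg by (simp only: of_nat_add of_nat_1) argo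
  then show ?thesis using that[of c] c by blast
qed

end

text \<open>\<open>K\<close> turns the unit steps of an \<open>S\<close>-geodesic into bounded steps
  for \<open>S0\<close>, so \<open>dist_path_le\<close> finds a point of it near the centre;
  \<open>K'\<close> converts back. The error is linear in \<open>k\<close>, hence logarithmic in the
  lengths.\<close>

lemma center_near_geodesics:
  assumes "hyperbolic_word_metric G S0 \<delta>" "word_metric G S"
  obtains A B :: nat where
    "\<And>k x y z u v w. \<lbrakk>x \<in> carrier G; y \<in> carrier G; z \<in> carrier G;
       word_metric.geodesic G S u x y; word_metric.geodesic G S v x z; word_metric.geodesic G S w y z;
       word_dist G S x y \<le> 2 ^ k; word_dist G S x z \<le> 2 ^ k; word_dist G S y z \<le> 2 ^ k\<rbrakk> \<Longrightarrow>
     \<exists>c\<in>carrier G. (\<exists>i\<le>word_dist G S x y. word_dist G S c (u i) \<le> A + B * k)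
       \<and> (\<exists>i\<le>word_dist G S x z. word_dist G S c (v i) \<le> A + B * k)
       \<and> (\<exists>i\<le>word_dist G S y z. word_dist G S c (w i) \<le> A + B * k)"
proof -
  interpret H: hyperbolic_word_metric G S0 \<delta> by fact
  interpret W: word_metric G S by fact
  obtain K where K: "\<And>x. x \<in> carrier G \<Longrightarrow> H.len x \<le> K * W.len x"
    using word_length_bilipschitz[OF W.word_metric_axioms H.word_metric_axioms] by blast
  obtain K' where K': "\<And>x. x \<in> carrier G \<Longrightarrow> W.len x \<le> K' * H.len x"
    using word_length_bilipschitz[OF H.word_metric_axioms W.word_metric_axioms] by blast
  define E where "E = nat \<lceil>\<delta>\<rceil>"
  have E: "\<delta> \<le> E" unfolding E_def by linarith
  have near: "\<exists>i\<le>W.d x y. W.d c (u i) \<le> K' * (E + 1 + K) + K' * E * k"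
    if c: "x \<in> carrier G" "y \<in> carrier G" "c \<in> carrier G" and u: "W.geodesic u x y" and k: "W.d x y \<le> 2 ^ k"
      and gp: "H.gromov_product c x y \<le> \<delta> + 1" for k x y c u
  proof -
    have closed: "u i \<in> carrier G" if "i \<le> W.d x y" for i using W.geodesic_ends(1)[OF u that] .
    have ends: "u 0 = x" "u (W.d x y) = y" using u by (auto simp only: W.geodesic_def)
    have "H.d (u i) (u (Suc i)) \<le> K" if "i < W.d x y" for i
    proof -
      have "W.d (u i) (u (Suc i)) = 1" using u that unfolding W.geodesic_def by auto
      then show ?thesis
        using K[of "inv\<^bsub>G\<^esub> (u i) \<otimes>\<^bsub>G\<^esub> u (Suc i)"] closed[of i] closed[of "Suc i"] that by (simp add: word_dist_def)
    qed
    then obtain i where i: "i \<le> W.d x y" "H.d c (u i) \<le> H.gromov_product c x y + k * \<delta> + K"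
      using H.dist_path_le[of "W.d x y" k c u K] k c closed ends by auto
    have "real k * \<delta> \<le> real k * real E" using E by (intro mult_left_mono) auto
    then have "real (H.d c (u i)) \<le> real (E + 1 + K + E * k)"
      using i(2) gp E by (simp add: algebra_simps)
    then have "H.d c (u i) \<le> E + 1 + K + E * k" by (simp only: of_nat_le_iff)
    then have "K' * H.d c (u i) \<le> K' * (E + 1 + K + E * k)" by (rule mult_le_mono2)
    moreover have "W.d c (u i) \<le> K' * H.d c (u i)"
      using K'[of "inv\<^bsub>G\<^esub> c \<otimes>\<^bsub>G\<^esub> u i"] closed[OF i(1)] c by (simp add: word_dist_def)
    ultimately show ?thesis using i(1) by (auto simp: algebra_simps)
  qed
  show ?thesis
  proof (rule that)
    fix k x y z u v w
    assume *: "x \<in> carrier G" "y \<in> carrier G" "z \<in> carrier G"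
       "W.geodesic u x y" "W.geodesic v x z" "W.geodesic w y z"
       "W.d x y \<le> 2 ^ k" "W.d x z \<le> 2 ^ k" "W.d y z \<le> 2 ^ k"
    obtain c where c: "c \<in> carrier G" "H.gromov_product c x y \<le> \<delta> + 1" "H.gromov_product c x z \<le> \<delta> + 1"
      "H.gromov_product c y z \<le> \<delta> + 1" using H.ex_center *(1-3) by blast
    show "\<exists>c\<in>carrier G. (\<exists>i\<le>W.d x y. W.d c (u i) \<le> K' * (E + 1 + K) + K' * E * k)
       \<and> (\<exists>i\<le>W.d x z. W.d c (v i) \<le> K' * (E + 1 + K) + K' * E * k)
       \<and> (\<exists>i\<le>W.d y z. W.d c (w i) \<le> K' * (E + 1 + K) + K' * E * k)"
      using near[OF *(1,2) c(1) *(4,7) c(2)] near[OF *(1,3) c(1) *(5,8) c(3)]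
        near[OF *(2,3) c(1) *(6,9) c(4)] c(1) by blast
  qed
qed

text \<open>If \<open>x\<close> and \<open>y\<close> on the sphere of radius \<open>n\<close> are at distance at most \<open>m\<close>, then the geodesic from
  \<open>\<one>\<close> to \<open>y\<close> stays close to the one to \<open>x\<close> until about distance \<open>m / 2\<close> from \<open>y\<close>.\<close>

lemma card_close_pairs:
  assumes "hyperbolic_word_metric G S0 \<delta>" "word_metric G S"
  obtains A B :: nat where
    "\<And>n k m D x. \<lbrakk>x \<in> word_sphere G S n; 2 * n \<le> 2 ^ k; D = A + B * k\<rbrakk> \<Longrightarrow>
     card {y \<in> word_sphere G S n. word_dist G S x y \<le> m}
       \<le> (n + 1) * (card (word_metric.ball_at_one G S (2 * D)) * card (word_metric.ball_at_one G S (m div 2 + 3 * D)))"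
proof -
  interpret W: word_metric G S by fact
  obtain A B where AB:
    "\<And>k x y z u v w. \<lbrakk>x \<in> carrier G; y \<in> carrier G; z \<in> carrier G;
       W.geodesic u x y; W.geodesic v x z; W.geodesic w y z;
       W.d x y \<le> 2 ^ k; W.d x z \<le> 2 ^ k; W.d y z \<le> 2 ^ k\<rbrakk> \<Longrightarrow>
     \<exists>c\<in>carrier G. (\<exists>i\<le>W.d x y. W.d c (u i) \<le> A + B * k)
       \<and> (\<exists>i\<le>W.d x z. W.d c (v i) \<le> A + B * k)
       \<and> (\<exists>i\<le>W.d y z. W.d c (w i) \<le> A + B * k)"
    using center_near_geodesics[OF assms] by metis
  show ?thesis
  proof (rule that)
    fix n k m D x
    assume x: "x \<in> word_sphere G S n" and k: "2 * n \<le> 2 ^ k" and D: "D = A + B * k"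
    let ?e = "\<one>\<^bsub>G\<^esub>"
    have xG: "x \<in> carrier G" "W.len x = n" using x by (auto simp: W.word_sphere_eq)
    obtain u where u: "W.geodesic u ?e x" using W.ex_geodesic xG by blast
    \<comment> \<open>Reach \<open>y\<close> along the fixed geodesic to \<open>x\<close>, then by a
      short jump \<open>b\<close> to the geodesic to \<open>y\<close>, then by the rest
      \<open>b'\<close> of that geodesic. Counting the triples bounds the number of
      \<open>y\<close>.\<close>
    define f where "f = (\<lambda>(i, b, b'). u i \<otimes>\<^bsub>G\<^esub> (b \<otimes>\<^bsub>G\<^esub> b'))"
    let ?P = "{..n} \<times> W.ball_at_one (2 * D) \<times> W.ball_at_one (m div 2 + 3 * D)"
    have "{y \<in> word_sphere G S n. W.d x y \<le> m} \<subseteq> f ` ?P"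
    proof
      fix y assume y: "y \<in> {y \<in> word_sphere G S n. W.d x y \<le> m}"
      then have yG: "y \<in> carrier G" "W.len y = n" "W.d x y \<le> m" by (auto simp: W.word_sphere_eq)
      obtain v where v: "W.geodesic v ?e y" using W.ex_geodesic yG by blast
      obtain w where w: "W.geodesic w x y" using W.ex_geodesic xG yG by blast
      have de: "W.d ?e x = n" "W.d ?e y = n" using W.d_one xG yG by auto
      moreover have "W.d x y \<le> 2 * n"
        using W.d_triangle[of x ?e y] W.d_commute[of x ?e] xG yG de by simp
      ultimately obtain c i j l where c: "c \<in> carrier G" "i \<le> n" "j \<le> n" "l \<le> W.d x y"
        "W.d c (u i) \<le> D" "W.d c (v j) \<le> D" "W.d c (w l) \<le> D"
        using AB[OF _ xG(1) yG(1) u v w, of k] k D by auto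
      note ui = W.geodesic_ends[OF u, of i, unfolded de, OF c(2)]
        and vj = W.geodesic_ends[OF v, of j, unfolded de, OF c(3)]
        and wl = W.geodesic_ends[OF w c(4)]
      have D2: "W.d p q \<le> 2 * D" if "W.d c p \<le> D" "W.d c q \<le> D" "p \<in> carrier G" "q \<in> carrier G" for p q
        using W.d_triangle[of p c q] W.d_commute[of p c] that c(1) by simp
      have uv: "W.d (u i) (v j) \<le> 2 * D" and uw: "W.d (u i) (w l) \<le> 2 * D" and wv: "W.d (v j) (w l) \<le> 2 * D"
        using D2 c ui vj wl by blast+
      \<comment> \<open>Adding this and the next two estimates cancels \<open>i\<close> and
        \<open>l\<close> and leaves \<open>2 * (n - j) \<le> m + 6 * D\<close>.\<close>
      have "i \<le> j + 2 * D"
        using W.d_triangle[of ?e "v j" "u i"] W.d_commute[of "v j" "u i"] ui vj uv by simp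
      moreover have "n - i \<le> l + 2 * D"
        using W.d_triangle[of x "w l" "u i"] W.d_commute[of x "u i"] W.d_commute[of "w l" "u i"] ui wl uw xG by simp
      moreover have "n - j \<le> W.d x y - l + 2 * D"
        using W.d_triangle[of "v j" "w l" y] vj wl wv yG by simp
      ultimately have "n - j \<le> m div 2 + 3 * D" using c(2-4) yG(3) by linarith
      then have "inv\<^bsub>G\<^esub> (v j) \<otimes>\<^bsub>G\<^esub> y \<in> W.ball_at_one (m div 2 + 3 * D)"
        using vj yG by (simp add: W.ball_at_one_def flip: word_dist_def)
      moreover have "inv\<^bsub>G\<^esub> (u i) \<otimes>\<^bsub>G\<^esub> v j \<in> W.ball_at_one (2 * D)"
        using ui vj uv by (simp add: W.ball_at_one_def flip: word_dist_def)
      moreover have "y = f (i, inv\<^bsub>G\<^esub> (u i) \<otimes>\<^bsub>G\<^esub> v j, inv\<^bsub>G\<^esub> (v j) \<otimes>\<^bsub>G\<^esub> y)"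
        using ui vj yG by (simp add: f_def W.m_assoc)
      ultimately show "y \<in> f ` ?P" using c(2) by blast
    qed
    moreover have fin: "finite ?P" using W.finite_ball_at_one by blast
    ultimately have "card {y \<in> word_sphere G S n. W.d x y \<le> m} \<le> card (f ` ?P)"
      by (intro card_mono) auto
    also have "\<dots> \<le> card ?P" using card_image_le[OF fin] .
    finally show "card {y \<in> word_sphere G S n. W.d x y \<le> m}
       \<le> (n + 1) * (card (W.ball_at_one (2 * D)) * card (W.ball_at_one (m div 2 + 3 * D)))"
      by (simp add: card_cartesian_product)
  qed
qed

section \<open>The growth rate\<close>

text \<open>The growth rate \<open>h\<close> is the infimum of \<open>ln (s n) / n\<close>, as in Fekete's lemma.\<close>

lemma submultiplicative_growth:
  fixes s :: "nat \<Rightarrow> real"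
  assumes ge_1: "\<And>n. 1 \<le> s n" and submult: "\<And>m n. s (m + n) \<le> s m * s n"
  obtains h where "0 \<le> h" "\<And>n. exp (h * n) \<le> s n"
    "\<And>\<eta>. 0 < \<eta> \<Longrightarrow> \<exists>C\<ge>1. \<forall>n. s n \<le> C * exp ((h + \<eta>) * n)"
proof -
  define A where "A = (\<lambda>n. ln (s n) / real n) ` {1..}"
  define h where "h = Inf A"
  have pos: "0 < s n" for n using ge_1[of n] by linarith
  have A: "A \<noteq> {}" "\<And>a. a \<in> A \<Longrightarrow> 0 \<le> a"
    using ge_1 by (auto simp: A_def)
  then have bdd: "bdd_below A" by (meson bdd_belowI)
  have h0: "0 \<le> h" unfolding h_def using A by (intro cInf_greatest)
  have lower: "exp (h * n) \<le> s n" for n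
  proof (cases "n = 0")
    case False
    then have "h \<le> ln (s n) / n" unfolding h_def using bdd by (intro cInf_lower) (auto simp: A_def)
    then have "h * n \<le> ln (s n)" using False by (simp add: field_simps)
    then show ?thesis using pos[of n] by (simp add: ln_ge_iff)
  qed (use ge_1 in simp)
  have "\<exists>C\<ge>1. \<forall>n. s n \<le> C * exp ((h + \<eta>) * n)" if "0 < \<eta>" for \<eta>
  proof -
    have "\<exists>a\<in>A. a < h + \<eta>" using cInf_lessD[OF A(1), of "h + \<eta>"] that by (auto simp: h_def)
    then obtain m where m: "1 \<le> m" "ln (s m) / m < h + \<eta>" by (auto simp: A_def)
    \<comment> \<open>\<open>C\<close> absorbs the factor \<open>s r\<close> for the remainder
      \<open>r\<close> of \<open>n\<close> modulo \<open>m\<close>.\<close>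
    define C where "C = (\<Sum>r<m. s r)"
    have "ln (s m) \<le> (h + \<eta>) * m" using m by (simp add: field_simps)
    then have "s m \<le> exp ((h + \<eta>) * m)"
      using pos[of m] by (metis exp_le_cancel_iff exp_ln)
    have s_mult: "s (q * m + r) \<le> s m ^ q * s r" for q r
    proof (induction q)
      case (Suc q)
      have "s (Suc q * m + r) \<le> s m * s (q * m + r)"
        using submult[of m "q * m + r"] by (simp add: add.assoc)
      also have "\<dots> \<le> s m * (s m ^ q * s r)"
        using Suc pos[of m] by (intro mult_left_mono) auto
      finally show ?case by (simp add: mult.assoc)
    qed simp
    have "s n \<le> C * exp ((h + \<eta>) * n)" for n
    proof -
      define q r where "q = n div m" and "r = n mod m"
      have n: "n = q * m + r" "r < m" using m by (simp_all add: q_def r_def)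
      have "s m ^ q \<le> exp ((h + \<eta>) * m) ^ q"
        using \<open>s m \<le> _\<close> pos[of m] by (intro power_mono) auto
      also have "\<dots> = exp ((h + \<eta>) * real (q * m))"
        by (simp add: exp_of_nat_mult[symmetric] algebra_simps)
      also have "\<dots> \<le> exp ((h + \<eta>) * n)"
        using h0 that n by (simp add: mult_left_mono)
      finally have 1: "s m ^ q \<le> exp ((h + \<eta>) * n)" .
      have 2: "s r \<le> C"
        unfolding C_def using n pos by (intro member_le_sum) (auto intro: less_imp_le)
      have "s n \<le> s m ^ q * s r" using s_mult[of q r] n by simp
      also have "\<dots> \<le> exp ((h + \<eta>) * n) * C"
        using 1 2 pos[of r] by (intro mult_mono) auto
      finally show ?thesis by (simp add: mult.commute)
    qed
    moreover have "1 \<le> C"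
    proof -
      have "s 0 \<le> C" unfolding C_def using m pos by (intro member_le_sum) (auto intro: less_imp_le)
      then show ?thesis using ge_1[of 0] by linarith
    qed
    ultimately show ?thesis by blast
  qed
  then show ?thesis using that h0 lower by blast
qed

section \<open>Growth of spheres and balls\<close>

context word_metric
begin

lemma card_word_sphere_add:
  "card (word_sphere G S (m + n)) \<le> card (word_sphere G S m) * card (word_sphere G S n)"
proof -
  let ?P = "word_sphere G S m \<times> word_sphere G S n"
  have "word_sphere G S (m + n) \<subseteq> (\<lambda>(x, y). x \<otimes> y) ` ?P"
  proof
    fix x assume "x \<in> word_sphere G S (m + n)"
    then have "x \<in> carrier G" "len x = m + n" by (auto simp: word_sphere_eq)
    then obtain u v where "u \<in> carrier G" "v \<in> carrier G" "x = u \<otimes> v" "len u = m" "len v = n"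
      using len_split by blast
    then show "x \<in> (\<lambda>(x, y). x \<otimes> y) ` ?P" by (auto simp: word_sphere_eq intro!: image_eqI[of _ _ "(u, v)"])
  qed
  then have "card (word_sphere G S (m + n)) \<le> card ?P"
    using finite_word_sphere by (intro surj_card_le) auto
  then show ?thesis by (simp add: card_cartesian_product)
qed

lemma card_ball_at_one: "card (ball_at_one n) = (\<Sum>k\<le>n. card (word_sphere G S k))"
proof -
  have "ball_at_one n = (\<Union>k\<in>{..n}. word_sphere G S k)"
    by (auto simp: ball_at_one_def word_sphere_eq)
  then show ?thesis
    using finite_word_sphere by (simp add: card_UN_disjoint word_sphere_eq disjoint_iff)
qed

lemma sphere_growth:
  assumes inf: "infinite (carrier G)" and expo: "\<And>n. 2 ^ n \<le> card (ball_at_one (M * n))"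
  obtains h where "0 < h" "\<And>n. exp (h * n) \<le> card (word_sphere G S n)"
    "\<And>\<eta>. 0 < \<eta> \<Longrightarrow> \<exists>C\<ge>1. \<forall>n. card (ball_at_one n) \<le> C * (n + 1) * exp ((h + \<eta>) * n)"
proof -
  have "1 \<le> real (card (word_sphere G S n))" for n
    using word_sphere_nonempty[OF inf, of n] finite_word_sphere[of n] by (simp add: Suc_le_eq card_gt_0_iff)
  moreover have "real (card (word_sphere G S (m + n)))
      \<le> real (card (word_sphere G S m)) * real (card (word_sphere G S n))" for m n
    using card_word_sphere_add[of m n] by (simp flip: of_nat_mult)
  ultimately obtain h where h: "0 \<le> h" "\<And>n. exp (h * n) \<le> card (word_sphere G S n)"
    "\<And>\<eta>. 0 < \<eta> \<Longrightarrow> \<exists>C\<ge>1. \<forall>n. card (word_sphere G S n) \<le> C * exp ((h + \<eta>) * n)"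
    using submultiplicative_growth[of "\<lambda>n. real (card (word_sphere G S n))"] by blast
  have ball: "\<exists>C\<ge>1. \<forall>n. card (ball_at_one n) \<le> C * (n + 1) * exp ((h + \<eta>) * n)" if "0 < \<eta>" for \<eta>
  proof -
    obtain C where C: "1 \<le> C" "\<And>n. card (word_sphere G S n) \<le> C * exp ((h + \<eta>) * n)"
      using h(3)[OF \<open>0 < \<eta>\<close>] by blast
    have "card (ball_at_one n) \<le> C * (n + 1) * exp ((h + \<eta>) * n)" for n
    proof -
      have "real (card (ball_at_one n)) = (\<Sum>k\<le>n. real (card (word_sphere G S k)))"
        by (simp add: card_ball_at_one)
      also have "\<dots> \<le> (\<Sum>k\<le>n. C * exp ((h + \<eta>) * n))"
      proof (rule sum_mono)
        fix k assume "k \<in> {..n}"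
        then have "C * exp ((h + \<eta>) * k) \<le> C * exp ((h + \<eta>) * n)"
          using C(1) h(1) \<open>0 < \<eta>\<close> by (intro mult_left_mono) (auto intro!: mult_left_mono)
        then show "real (card (word_sphere G S k)) \<le> C * exp ((h + \<eta>) * n)"
          using C(2)[of k] by linarith
      qed
      finally show ?thesis by (simp add: algebra_simps)
    qed
    then show ?thesis using C(1) by blast
  qed
  have "h \<noteq> 0"
  proof
    assume "h = 0"
    \<comment> \<open>For \<open>h = 0\<close> this rate gives the ball of radius
      \<open>M * n\<close> at most \<open>exp (ln 2 / 2 * n)\<close> elements up to a linear factor,
      against the assumed \<open>2 ^ n\<close>. The \<open>+ 1\<close> allows
      \<open>M = 0\<close>.\<close>
    define \<eta> where "\<eta> = ln 2 / (2 * (real M + 1))"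
    have \<eta>: "0 < \<eta>" "\<eta> * M \<le> ln 2 / 2"
      by (auto simp: \<eta>_def field_simps)
    obtain C where C: "1 \<le> C" "\<And>n. card (ball_at_one n) \<le> C * (n + 1) * exp ((h + \<eta>) * n)"
      using ball[OF \<eta>(1)] by blast
    have le: "exp (ln 2 / 2 * real n) / (real n + 1) \<le> C * (M + 1)" for n
    proof -
      have "exp (ln 2 * real n) = 2 ^ n" by (simp add: mult.commute[of "ln 2"] exp_of_nat_mult)
      also have "\<dots> \<le> real (card (ball_at_one (M * n)))"
        using expo[of n] by (simp add: numeral_power_le_of_nat_cancel_iff)
      also have "\<dots> \<le> C * (real (M * n) + 1) * exp (\<eta> * real (M * n))"
        using C(2)[of "M * n"] \<open>h = 0\<close> by simp
      also have "\<dots> \<le> C * ((real M + 1) * (real n + 1)) * exp (ln 2 / 2 * real n)"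
      proof (intro mult_mono)
        have "\<eta> * M * n \<le> ln 2 / 2 * n" using \<eta>(2) by (intro mult_right_mono) auto
        then show "exp (\<eta> * real (M * n)) \<le> exp (ln 2 / 2 * real n)" by (simp add: mult.assoc)
      qed (use C(1) in \<open>auto simp: algebra_simps\<close>)
      finally have "exp (ln 2 / 2 * real n) * exp (ln 2 / 2 * real n)
          \<le> C * ((real M + 1) * (real n + 1)) * exp (ln 2 / 2 * real n)"
        by (simp add: mult.commute flip: exp_add)
      then have "exp (ln 2 / 2 * real n) \<le> C * ((real M + 1) * (real n + 1))"
        by (rule mult_right_le_imp_le) simp
      then show ?thesis by (simp add: divide_le_eq mult.assoc add.commute)
    qed
    have "filterlim (\<lambda>n. exp (ln 2 / 2 * real n) / (real n + 1)) at_top sequentially"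
      by real_asymp
    then have "eventually (\<lambda>n. C * (M + 1) < exp (ln 2 / 2 * real n) / (real n + 1)) sequentially"
      by (simp add: filterlim_at_top_dense)
    then obtain n where "C * (M + 1) < exp (ln 2 / 2 * real n) / (real n + 1)"
      using eventually_happens by fastforce
    then show False using le[of n] by linarith
  qed
  then show ?thesis using that[of h] h ball by simp
qed

end

lemma log_le_ln: "log 2 x \<le> 2 * ln x" if "1 \<le> x" for x :: real
proof -
  have "1 / 2 \<le> ln (2 :: real)" by (subst ln_ge_iff) (use exp_half_le2 in auto)
  then have "ln x * 1 \<le> ln x * (2 * ln 2)" using that by (intro mult_left_mono) auto
  then show ?thesis by (simp add: log_def field_simps)
qed

section \<open>The sprawl\<close>

lemma close_pairs_negligible:
  assumes hyp: "hyperbolic_word_metric G S0 \<delta>" and "word_metric G S" and nonel: "\<not> elementary_group G"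
    and \<epsilon>: "0 < \<epsilon>" "\<epsilon> < 1"
  obtains f :: "nat \<Rightarrow> real" where "f \<longlonglongrightarrow> 0"
    "\<And>n x. \<lbrakk>1 \<le> n; x \<in> word_sphere G S n\<rbrakk> \<Longrightarrow>
       card {y \<in> word_sphere G S n. real (word_dist G S x y) \<le> (2 - 2 * \<epsilon>) * n}
         \<le> f n * card (word_sphere G S n)"
proof -
  interpret H: hyperbolic_word_metric G S0 \<delta> by fact
  interpret W: word_metric G S by fact
  have inf: "infinite (carrier G)" using nonel by (simp add: elementary_group_def)
  obtain M0 where M0: "\<And>n. 2 ^ n \<le> card (H.ball_at_one (M0 * n))"
    using H.exponential_ball_growth[OF nonel] by blast
  obtain K where K: "\<And>x. x \<in> carrier G \<Longrightarrow> W.len x \<le> K * H.len x"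
    using word_length_bilipschitz[OF H.word_metric_axioms W.word_metric_axioms] by blast
  \<comment> \<open>The tree was built in the hyperbolic metric of \<open>S0\<close>; its
    exponential growth passes to \<open>S\<close> because the radius changes only by the factor
    \<open>K\<close>.\<close>
  have "2 ^ n \<le> card (W.ball_at_one (K * M0 * n))" for n
  proof -
    have "H.ball_at_one (M0 * n) \<subseteq> W.ball_at_one (K * M0 * n)"
    proof
      fix x assume x: "x \<in> H.ball_at_one (M0 * n)"
      then have "K * H.len x \<le> K * (M0 * n)"
        by (intro mult_le_mono2) (simp add: H.ball_at_one_def)
      then show "x \<in> W.ball_at_one (K * M0 * n)"
        using K[of x] x by (auto simp: H.ball_at_one_def W.ball_at_one_def mult.assoc intro: order_trans)
    qed
    then show ?thesis using card_mono[OF W.finite_ball_at_one] M0[of n] by (meson order_trans)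
  qed
  then obtain h where h: "0 < h" "\<And>n. exp (h * n) \<le> card (word_sphere G S n)"
    "\<And>\<eta>. 0 < \<eta> \<Longrightarrow> \<exists>C\<ge>1. \<forall>n. card (W.ball_at_one n) \<le> C * (n + 1) * exp ((h + \<eta>) * n)"
    using W.sphere_growth[OF inf] by blast
  \<comment> \<open>This choice makes \<open>a * (1 - \<epsilon>) < h\<close>.\<close>
  define a where "a = h + h * \<epsilon>"
  have "0 < h * \<epsilon>" using h(1) \<epsilon> by simp
  then have a: "0 < a" using h(1) by (simp add: a_def)
  obtain C where C: "1 \<le> C" "\<And>n. card (W.ball_at_one n) \<le> C * (n + 1) * exp (a * n)"
    using h(3)[OF \<open>0 < h * \<epsilon>\<close>] unfolding a_def by blast
  obtain A B where AB: "\<And>n k m D x. \<lbrakk>x \<in> word_sphere G S n; 2 * n \<le> 2 ^ k; D = A + B * k\<rbrakk> \<Longrightarrow>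
     card {y \<in> word_sphere G S n. word_dist G S x y \<le> m}
       \<le> (n + 1) * (card (W.ball_at_one (2 * D)) * card (W.ball_at_one (m div 2 + 3 * D)))"
    by (rule card_close_pairs[OF assms(1,2)]) (rule that)
  define E where "E = real A + 4 * real B + 1"
  have E: "0 < E" by (simp add: E_def)
  \<comment> \<open>\<open>f\<close> is the bound of \<open>card_close_pairs\<close> divided by
    \<open>exp (h * n)\<close>, with \<open>E * (ln n + 1)\<close> for \<open>D\<close>. The radii
    \<open>2 * D\<close> and \<open>3 * D\<close> give the factor \<open>5\<close>, and
    \<open>a * (1 - \<epsilon>) - h = - h * \<epsilon>\<^sup>2\<close> gives the decay.\<close>
  define f where "f = (\<lambda>n::nat. (real n + 1) * ((C * (2 * (E * (ln n + 1)) + 1)) * (C * (real n + 3 * (E * (ln n + 1)) + 1)))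
      * exp (5 * a * (E * (ln n + 1)) - h * \<epsilon>\<^sup>2 * n))"
  have "f \<longlonglongrightarrow> 0"
  proof -
    have "0 < C" "0 < h * \<epsilon>\<^sup>2" using C(1) h(1) \<epsilon> by auto
    define b c where "b = 5 * a * E" and "c = h * \<epsilon>\<^sup>2"
    have "0 < b" "0 < c" using a E \<open>0 < h * \<epsilon>\<^sup>2\<close> by (simp_all add: b_def c_def)
    have "(\<lambda>n::nat. (real n + 1) * ((C * (2 * (E * (ln n + 1)) + 1)) * (C * (real n + 3 * (E * (ln n + 1)) + 1)))
      * exp (b * (ln n + 1) - c * n)) \<longlonglongrightarrow> 0"
      using \<open>0 < b\<close> \<open>0 < c\<close> \<open>0 < C\<close> E by real_asymp
    then show ?thesis by (simp add: f_def b_def c_def mult.assoc)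
  qed
  moreover have "card {y \<in> word_sphere G S n. real (W.d x y) \<le> (2 - 2 * \<epsilon>) * n} \<le> f n * card (word_sphere G S n)"
    if n: "1 \<le> n" and x: "x \<in> word_sphere G S n" for n x
  proof -
    \<comment> \<open>The least admissible exponent with \<open>2 * n \<le> 2 ^ k\<close> keeps
      \<open>D\<close> of order \<open>ln n\<close>.\<close>
    define k where "k = nat \<lceil>log 2 (2 * real n)\<rceil>"
    have log: "log 2 (2 * real n) = 1 + log 2 n" "0 \<le> log 2 (real n)" "log 2 (real n) \<le> 2 * ln n"
      using n log_le_ln[of "real n"] by (simp_all add: log_mult)
    then have "log 2 (2 * real n) \<le> k" "0 \<le> log 2 (2 * real n)" "real k \<le> 2 * ln n + 2"
      unfolding k_def by linarith+
    have "real (2 * n) \<le> 2 powr k"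
      using \<open>log 2 (2 * real n) \<le> k\<close> n by (simp add: log_le_iff)
    then have k: "2 * n \<le> 2 ^ k"
      by (simp add: powr_realpow numeral_power_le_of_nat_cancel_iff of_nat_le_numeral_power_cancel_iff flip: of_nat_mult)
    define D where "D = A + B * k"
    have ln0: "0 \<le> ln (real n)" using n by simp
    have "real B * k \<le> B * (2 * ln n + 2)" using \<open>real k \<le> _\<close> by (intro mult_left_mono) auto
    also have "\<dots> = 2 * (B * ln n) + 2 * B" by (simp add: algebra_simps)
    finally have "real D \<le> A + 2 * (B * ln n) + 2 * B" by (simp add: D_def)
    also have "\<dots> \<le> A * ln n + 4 * (B * ln n) + ln n + A + 4 * B + 1" using ln0 by simp
    also have "\<dots> = E * (ln n + 1)" by (simp add: E_def algebra_simps)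
    finally have D: "D \<le> E * (ln n + 1)" .
    define m where "m = nat \<lfloor>(2 - 2 * \<epsilon>) * n\<rfloor>"
    have m0: "0 \<le> (2 - 2 * \<epsilon>) * n" using \<epsilon> by simp
    have m: "real (m div 2) \<le> (1 - \<epsilon>) * n"
    proof -
      have "2 * real (m div 2) \<le> real m" by linarith
      also have "\<dots> \<le> (2 - 2 * \<epsilon>) * n" using m0 unfolding m_def by linarith
      finally show ?thesis by (simp add: algebra_simps)
    qed
    have sub: "{y \<in> word_sphere G S n. real (W.d x y) \<le> (2 - 2 * \<epsilon>) * n}
        \<subseteq> {y \<in> word_sphere G S n. W.d x y \<le> m}"
      unfolding m_def by (auto simp: le_nat_floor)
    have b1: "card (W.ball_at_one (2 * D)) \<le> C * (2 * (E * (ln n + 1)) + 1) * exp (a * (2 * (E * (ln n + 1))))"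
    proof -
      have "card (W.ball_at_one (2 * D)) \<le> C * (real (2 * D) + 1) * exp (a * real (2 * D))"
        using C(2)[of "2 * D"] by simp
      also have "\<dots> \<le> C * (2 * (E * (ln n + 1)) + 1) * exp (a * (2 * (E * (ln n + 1))))"
        using C(1) a D ln0 E by (intro mult_mono) (auto intro!: mult_nonneg_nonneg)
      finally show ?thesis .
    qed
    have b2: "card (W.ball_at_one (m div 2 + 3 * D))
        \<le> C * (real n + 3 * (E * (ln n + 1)) + 1) * exp (a * ((1 - \<epsilon>) * n + 3 * (E * (ln n + 1))))"
    proof -
      have "(1 - \<epsilon>) * n \<le> n" using \<epsilon> by (simp add: algebra_simps)
      then have "card (W.ball_at_one (m div 2 + 3 * D))
          \<le> C * (real (m div 2 + 3 * D) + 1) * exp (a * real (m div 2 + 3 * D))"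
        using C(2)[of "m div 2 + 3 * D"] by simp
      also have "\<dots> \<le> C * (real n + 3 * (E * (ln n + 1)) + 1) * exp (a * ((1 - \<epsilon>) * n + 3 * (E * (ln n + 1))))"
      proof (intro mult_mono)
        show "real (m div 2 + 3 * D) + 1 \<le> real n + 3 * (E * (ln n + 1)) + 1"
          using m D \<open>(1 - \<epsilon>) * n \<le> n\<close> by simp
        have "real (m div 2 + 3 * D) \<le> (1 - \<epsilon>) * n + 3 * (E * (ln n + 1))" using m D by simp
        then show "exp (a * real (m div 2 + 3 * D)) \<le> exp (a * ((1 - \<epsilon>) * n + 3 * (E * (ln n + 1))))"
          using a by simp
      qed (use C(1) E ln0 in auto)
      finally show ?thesis .
    qed
    have "real (card {y \<in> word_sphere G S n. real (W.d x y) \<le> (2 - 2 * \<epsilon>) * n})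
        \<le> real (card {y \<in> word_sphere G S n. W.d x y \<le> m})"
      using sub W.finite_word_sphere[of n] by (simp add: card_mono)
    also have "\<dots> \<le> real ((n + 1) * (card (W.ball_at_one (2 * D)) * card (W.ball_at_one (m div 2 + 3 * D))))"
      using AB[OF x k D_def, of m] by (simp only: of_nat_le_iff)
    also have "\<dots> = (real n + 1) * (real (card (W.ball_at_one (2 * D))) * real (card (W.ball_at_one (m div 2 + 3 * D))))"
      by (simp add: algebra_simps)
    also have "\<dots> \<le> (real n + 1) * ((C * (2 * (E * (ln n + 1)) + 1) * exp (a * (2 * (E * (ln n + 1)))))
        * (C * (real n + 3 * (E * (ln n + 1)) + 1) * exp (a * ((1 - \<epsilon>) * n + 3 * (E * (ln n + 1))))))"
      using b1 b2 C(1) E ln0 by (intro mult_left_mono mult_mono) auto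
    also have "\<dots> = (real n + 1) * ((C * (2 * (E * (ln n + 1)) + 1)) * (C * (real n + 3 * (E * (ln n + 1)) + 1)))
        * (exp (a * (2 * (E * (ln n + 1)))) * exp (a * ((1 - \<epsilon>) * n + 3 * (E * (ln n + 1)))))"
      by (simp only: ac_simps)
    also have "exp (a * (2 * (E * (ln n + 1)))) * exp (a * ((1 - \<epsilon>) * n + 3 * (E * (ln n + 1))))
        = exp (5 * a * (E * (ln n + 1)) - h * \<epsilon>\<^sup>2 * n) * exp (h * n)"
      unfolding exp_add[symmetric] a_def by (rule arg_cong[of _ _ exp]) (simp add: algebra_simps power2_eq_square)
    also have "(real n + 1) * ((C * (2 * (E * (ln n + 1)) + 1)) * (C * (real n + 3 * (E * (ln n + 1)) + 1)))
        * (exp (5 * a * (E * (ln n + 1)) - h * \<epsilon>\<^sup>2 * n) * exp (h * n)) = f n * exp (h * n)"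
      by (simp add: f_def mult.assoc)
    also have "\<dots> \<le> f n * card (word_sphere G S n)"
      using h(2)[of n] C(1) E ln0 by (intro mult_left_mono) (auto simp: f_def)
    finally show ?thesis .
  qed
  ultimately show ?thesis by (rule that)
qed

section \<open>Bounds for the sprawl sequence\<close>

lemma (in word_metric) sprawl_seq_le:
  assumes "infinite (carrier G)" "1 \<le> n"
  shows "sprawl_seq G S n \<le> 2"
proof -
  let ?X = "word_sphere G S n"
  have pos: "0 < card ?X"
    using word_sphere_nonempty[OF assms(1), of n] finite_word_sphere by (simp add: card_gt_0_iff)
  have "1 / real n * real (d x y) \<le> 2" if "x \<in> ?X" "y \<in> ?X" for x y
  proof -
    have "d x y \<le> n + n"
      using d_triangle[of x \<one> y] d_commute[of x \<one>] that by (auto simp: word_sphere_eq d_one)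
    then show ?thesis using assms(2) by (simp add: field_simps)
  qed
  then have "(\<Sum>x\<in>?X. \<Sum>y\<in>?X. 1 / real n * real (d x y)) \<le> (\<Sum>x\<in>?X. \<Sum>y\<in>?X. 2)"
    by (intro sum_mono) auto
  then show ?thesis using pos by (simp add: sprawl_seq_def field_simps power2_eq_square)
qed

text \<open>Discard the close pairs: for each \<open>x\<close> a proportion of at least
  \<open>1 - q\<close> of the sphere remains and contributes at least
  \<open>2 - 2 * \<epsilon>\<close> per point.\<close>

lemma (in word_metric) sprawl_seq_ge:
  fixes q \<epsilon> :: real
  assumes inf: "infinite (carrier G)" "1 \<le> n" and \<epsilon>: "\<epsilon> \<le> 1"
    and close: "\<And>x. x \<in> word_sphere G S n \<Longrightarrow>
      card {y \<in> word_sphere G S n. real (d x y) \<le> (2 - 2 * \<epsilon>) * n} \<le> q * card (word_sphere G S n)"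
  shows "(2 - 2 * \<epsilon>) * (1 - q) \<le> sprawl_seq G S n"
proof -
  let ?X = "word_sphere G S n"
  define N where "N = real (card ?X)"
  have pos: "0 < N"
    using word_sphere_nonempty[OF inf(1), of n] finite_word_sphere by (simp add: N_def card_gt_0_iff)
  have inner: "(2 - 2 * \<epsilon>) * ((1 - q) * N) \<le> (\<Sum>y\<in>?X. 1 / real n * real (d x y))" if x: "x \<in> ?X" for x
  proof -
    define Y where "Y = {y \<in> ?X. real (d x y) \<le> (2 - 2 * \<epsilon>) * n}"
    have Y: "Y \<subseteq> ?X" "finite Y" using finite_word_sphere[of n] by (auto simp: Y_def)
    have "card Y \<le> q * N" using close[OF x] by (simp only: Y_def N_def)
    moreover have "real (card (?X - Y)) = N - card Y"
      using Y card_mono[OF finite_word_sphere Y(1)] by (simp add: N_def card_Diff_subset)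
    ultimately have "(1 - q) * N \<le> real (card (?X - Y))"
      by (simp add: algebra_simps)
    then have "(2 - 2 * \<epsilon>) * ((1 - q) * N) \<le> (2 - 2 * \<epsilon>) * card (?X - Y)"
      using \<epsilon> by (intro mult_left_mono) auto
    also have "\<dots> = (\<Sum>y\<in>?X - Y. 2 - 2 * \<epsilon>)" by simp
    also have "\<dots> \<le> (\<Sum>y\<in>?X - Y. 1 / real n * real (d x y))"
      using inf(2) by (intro sum_mono) (auto simp: Y_def field_simps)
    also have "\<dots> \<le> (\<Sum>y\<in>?X. 1 / real n * real (d x y))"
      using finite_word_sphere by (intro sum_mono2) auto
    finally show ?thesis .
  qed
  have "(2 - 2 * \<epsilon>) * (1 - q) * N\<^sup>2 = (\<Sum>x\<in>?X. (2 - 2 * \<epsilon>) * ((1 - q) * N))"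
    by (simp add: N_def power2_eq_square)
  also have "\<dots> \<le> (\<Sum>x\<in>?X. \<Sum>y\<in>?X. 1 / real n * real (d x y))"
    by (intro sum_mono inner)
  finally show ?thesis
    using pos by (simp add: sprawl_seq_def N_def[symmetric] field_simps)
qed

theorem theorem4:
  fixes G :: "('a, 'b) monoid_scheme" and S :: "'a set"
  assumes "hyperbolic_group G"
    and "\<not> elementary_group G"
    and "finite_generating_set G S"
  shows "convergent (sprawl_seq G S) \<and> sprawl G S = 2"
proof -
  obtain S0 \<delta>0 where S0: "group G" "finite_generating_set G S0"
    "delta_hyperbolic (cayley_graph G S0) (cayley_dist G S0) \<delta>0"
    using assms(1) by (auto simp: hyperbolic_group_def)
  interpret group G by fact
  interpret S0: word_metric G S0 by unfold_locales fact
  interpret word_metric G S by unfold_locales fact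
  note hyp = S0.hyperbolic_word_metric_of_slim[OF S0(3)]
  have inf: "infinite (carrier G)" using assms(2) by (simp add: elementary_group_def)
  have "sprawl_seq G S \<longlonglongrightarrow> 2"
  proof (rule order_tendstoI)
    fix b :: real assume "2 < b"
    then show "eventually (\<lambda>n. sprawl_seq G S n < b) sequentially"
      using sprawl_seq_le[OF inf] by (intro eventually_sequentiallyI[of 1]) fastforce
  next
    fix b :: real assume b: "b < 2"
    \<comment> \<open>The quarter leaves \<open>2 - 2 * \<epsilon>\<close> strictly above
      \<open>b\<close>, and the minimum with \<open>1 / 2\<close> keeps \<open>\<epsilon>\<close>
      below \<open>1\<close>.\<close>
    define \<epsilon> where "\<epsilon> = min (1 / 2) ((2 - b) / 4)"
    have "\<epsilon> \<le> (2 - b) / 4" unfolding \<epsilon>_def by (rule min.cobounded2)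
    then have \<epsilon>: "0 < \<epsilon>" "\<epsilon> < 1" "b < 2 - 2 * \<epsilon>" using b by (auto simp: \<epsilon>_def)
    obtain f :: "nat \<Rightarrow> real" where f: "f \<longlonglongrightarrow> 0"
      "\<And>n x. \<lbrakk>1 \<le> n; x \<in> word_sphere G S n\<rbrakk> \<Longrightarrow>
       card {y \<in> word_sphere G S n. real (d x y) \<le> (2 - 2 * \<epsilon>) * n} \<le> f n * card (word_sphere G S n)"
      using close_pairs_negligible[OF hyp word_metric_axioms assms(2) \<epsilon>(1,2)] by blast
    have "(\<lambda>n. (2 - 2 * \<epsilon>) * (1 - f n)) \<longlonglongrightarrow> (2 - 2 * \<epsilon>) * (1 - 0)"
      using f(1) by (intro tendsto_intros)
    then have "eventually (\<lambda>n. b < (2 - 2 * \<epsilon>) * (1 - f n)) sequentially"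
      using \<epsilon>(3) by (intro order_tendstoD) auto
    then show "eventually (\<lambda>n. b < sprawl_seq G S n) sequentially"
      using eventually_ge_at_top[of 1]
    proof eventually_elim
      case (elim n)
      then show ?case using sprawl_seq_ge[OF inf elim(2) _ f(2)[OF elim(2)]] \<epsilon>(2) by force
    qed
  qed
  then show ?thesis by (auto simp: sprawl_def convergent_def limI)
qed

end
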